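(* For any integers $k\ge1$ and $n>k$, $$\inf_{I\in\mathcal I_{k,n}}\frac{\mathsf{DP}(I)}{\mathsf{Proph}(I)}=\inf_{\mathbf G}\ \mathrm{innerLP}^{\mathsf{DP}/\mathsf{Proph}}_{k,n}(\mathbf G)\qquad\text{and}\qquad\inf_{I\in\mathcal I_{k,n}}\frac{\mathsf{DP}(I)}{\mathsf{ExAnte}(I)}=\inf_{\mathbf G}\ \mathrm{innerLP}^{\mathsf{DP}/\mathsf{ExAnte}}_{k,n}(\mathbf G),$$ where $\inf_{\mathbf G}$ is over all type distributions $\mathbf G$ for $n$ agents (with any finite number $m$ of types).
   Context: $[n]=\{1,\dots,n\}$. $\mathrm{Ber}(p)$ is a Bernoulli random variable with mean $p$, independent within sums. Instances. $\mathcal I_{k,n}$ is the class of all instances $I$ with $k$ slots and $n$ agents: a positive integer $m$ (number of types), valuations $r_1\ge\cdots\ge r_m\ge0$, and probabilities $p_{ij}\ge0$ ($i\in[n],j\in[m]$) with $\sum_{j=1}^mp_{ij}=1$ for each $i$. Agents arrive in order $1,\dots,n$; agent $i$ independently has type $j$ with probability $p_{ij}$, and then has valuation $R_i=r_j$, revealed on arrival. On arrival of each agent one must irrevocably accept (using one of the $k$ slots, if any is left) or reject. $\mathsf{DP}(I)$ is the maximum, over all online policies knowing $I$, of the expected sum of valuations of accepted agents. $\mathsf{Proph}(I)=\mathbb E[\max_{S\subseteq[n],|S|\le k}\sum_{i\in S}R_i]$. $\mathsf{ExAnte}(I)=\max\{\sum_{j=1}^mr_ja_j:\ \sum_{j=1}^ma_j\le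 k,\ 0\le a_j\le\sum_{i=1}^np_{ij}\ \forall j\in[m]\}$. Infima of ratios are over instances with positive denominator. Type distributions $\mathbf G$ (for $n$ agents): a positive integer $m$ and numbers $G_{ij}$, $i\in[n]$, $j\in\{0,\dots,m\}$, with $0=G_{i0}\le G_{i1}\le\cdots\le G_{im}=1$ for every $i$ (corresponding to $G_{ij}=\sum_{j'\le j}p_{ij'}$). $\mathrm{innerLP}^{\mathsf{DP}/\mathsf{Proph}}_{k,n}(\mathbf G)$ (resp. $\mathrm{innerLP}^{\mathsf{DP}/\mathsf{ExAnte}}_{k,n}(\mathbf G)$) is the optimal value of: maximize $\theta$ over real $\theta,x^l_i,y^l_i$ ($i\in[n],l\in[k]$) subject to $$\theta\cdot Q_j\le\sum_{i=1}^n\sum_{l=1}^k\min\{y^l_i,G_{ij}x^l_i\}\ \ \forall j\in[m];\qquad 0\le y^l_i\le x^l_i\ \ \forall i,l;$$ $x^k_1=1$; $x^l_1=0$ for $l<k$; $x^l_i=x^l_{i-1}-y^l_{i-1}+y^{l+1}_{i-1}$ for $i>1$, $l\in[k]$ (with $y^{k+1}_i=0$), where $Q_j=\mathbb E[\min\{\sum_{i=1}^n\mathrm{Ber}(G_{ij}),k\}]$ (resp. $Q_j=\min\{\sum_{i=1}^nG_{ij},k\}$). *)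

theory Defs
  imports "HOL-Probability.Probability"
begin

text \<open>
  An instance with \<open>n\<close> agents is a triple \<open>(m, r, p)\<close>: agents are \<open>{1..n}\<close>, types are \<open>{1..m}\<close>,
  and \<open>pmf (p i) j\<close> is the probability that agent \<open>i\<close> has type \<open>j\<close>. Values of \<open>r\<close> and \<open>p\<close>
  outside these index ranges are irrelevant. The number \<open>k\<close> of slots does not constrain these data;
  it enters through the benchmarks below.
\<close>

definition instances :: "nat \<Rightarrow> (nat \<times> (nat \<Rightarrow> real) \<times> (nat \<Rightarrow> nat pmf)) set" where
  "instances n = {(m, r, p). m \<ge> 1 \<and> (\<forall>j\<in>{1..<m}. r (Suc j) \<le> r j) \<and> 0 \<le> r m \<and>
     (\<forall>i\<in>{1..n}. set_pmf (p i) \<subseteq> {1..m})}"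

definition types_pmf :: "nat \<Rightarrow> (nat \<Rightarrow> nat pmf) \<Rightarrow> (nat \<Rightarrow> nat) pmf" where
  "types_pmf n p = Pi_pmf {1..n} 0 p"

text \<open>
  A deterministic online policy maps each type profile \<open>t\<close> to the set of accepted agents. Being
  online means that the decision on agent \<open>i\<close> depends only on the types of agents \<open>1, \<dots>, i\<close>
  (earlier decisions are functions of these). A general, possibly randomized, policy is a
  probability distribution over deterministic ones, drawn independently of the types. As only finitely
  many type profiles have positive probability, countably supported distributions lose no generality.
\<close>

definition det_policies :: "nat \<Rightarrow> nat \<Rightarrow> ((nat \<Rightarrow> nat) \<Rightarrow> nat set) set" where
  "det_policies k n = {A. (\<forall>t. A t \<subseteq> {1..n} \<and> card (A t) \<le> k) \<and>
     (\<forall>i\<in>{1..n}. \<forall>t t'. (\<forall>i'\<in>{1..i}. t i' = t' i') \<longrightarrow> (i \<in> A t \<longleftrightarrow> i \<in> A t'))}"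

definition policies :: "nat \<Rightarrow> nat \<Rightarrow> ((nat \<Rightarrow> nat) \<Rightarrow> nat set) pmf set" where
  "policies k n = {D. set_pmf D \<subseteq> det_policies k n}"

definition policy_value ::
    "nat \<Rightarrow> (nat \<Rightarrow> real) \<Rightarrow> (nat \<Rightarrow> nat pmf) \<Rightarrow> ((nat \<Rightarrow> nat) \<Rightarrow> nat set) pmf \<Rightarrow> real" where
  "policy_value n r p D =
     measure_pmf.expectation (pair_pmf D (types_pmf n p)) (\<lambda>(A, t). \<Sum>i\<in>A t. r (t i))"

text \<open>
  The suprema of reals in \<open>DP\<close>, \<open>ExAnte\<close> and (for \<open>1 \<le> k < n\<close>) \<open>innerLP\<close> below are over nonempty
  bounded sets and are attained, so they are the maxima.
\<close>

definition DP :: "nat \<Rightarrow> nat \<Rightarrow> (nat \<Rightarrow> real) \<Rightarrow> (nat \<Rightarrow> nat pmf) \<Rightarrow> real" where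
  "DP k n r p = (SUP D\<in>policies k n. policy_value n r p D)"

definition Proph :: "nat \<Rightarrow> nat \<Rightarrow> (nat \<Rightarrow> real) \<Rightarrow> (nat \<Rightarrow> nat pmf) \<Rightarrow> real" where
  "Proph k n r p = measure_pmf.expectation (types_pmf n p)
     (\<lambda>t. Max ((\<lambda>S. \<Sum>i\<in>S. r (t i)) ` {S. S \<subseteq> {1..n} \<and> card S \<le> k}))"

definition ExAnte :: "nat \<Rightarrow> nat \<Rightarrow> nat \<Rightarrow> (nat \<Rightarrow> real) \<Rightarrow> (nat \<Rightarrow> nat pmf) \<Rightarrow> real" where
  "ExAnte k n m r p = (SUP a\<in>{a. (\<Sum>j=1..m. a j) \<le> real k \<and>
       (\<forall>j\<in>{1..m}. 0 \<le> a j \<and> a j \<le> (\<Sum>i=1..n. pmf (p i) j))}. \<Sum>j=1..m. r j * a j)"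

definition type_dists :: "nat \<Rightarrow> (nat \<times> (nat \<Rightarrow> nat \<Rightarrow> real)) set" where
  "type_dists n = {(m, G). m \<ge> 1 \<and> (\<forall>i\<in>{1..n}. G i 0 = 0 \<and> G i m = 1 \<and>
     (\<forall>j<m. G i j \<le> G i (Suc j)))}"

definition Q_Proph :: "nat \<Rightarrow> nat \<Rightarrow> (nat \<Rightarrow> nat \<Rightarrow> real) \<Rightarrow> nat \<Rightarrow> real" where
  "Q_Proph k n G j = measure_pmf.expectation (Pi_pmf {1..n} False (\<lambda>i. bernoulli_pmf (G i j)))
     (\<lambda>b. min (\<Sum>i=1..n. of_bool (b i)) (real k))"

definition Q_ExAnte :: "nat \<Rightarrow> nat \<Rightarrow> (nat \<Rightarrow> nat \<Rightarrow> real) \<Rightarrow> nat \<Rightarrow> real" where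
  "Q_ExAnte k n G j = min (\<Sum>i=1..n. G i j) (real k)"

text \<open>The variables \<open>x\<^sup>l\<^sub>i\<close> and \<open>y\<^sup>l\<^sub>i\<close> are written \<open>x i l\<close> and \<open>y i l\<close>.\<close>

definition innerLP_feasible ::
    "nat \<Rightarrow> nat \<Rightarrow> (nat \<Rightarrow> real) \<Rightarrow> nat \<Rightarrow> (nat \<Rightarrow> nat \<Rightarrow> real) \<Rightarrow>
     real \<Rightarrow> (nat \<Rightarrow> nat \<Rightarrow> real) \<Rightarrow> (nat \<Rightarrow> nat \<Rightarrow> real) \<Rightarrow> bool" where
  "innerLP_feasible k n Q m G \<theta> x y \<longleftrightarrow>
     (\<forall>j\<in>{1..m}. \<theta> * Q j \<le> (\<Sum>i=1..n. \<Sum>l=1..k. min (y i l) (G i j * x i l))) \<and>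
     (\<forall>i\<in>{1..n}. \<forall>l\<in>{1..k}. 0 \<le> y i l \<and> y i l \<le> x i l) \<and>
     x 1 k = 1 \<and> (\<forall>l\<in>{1..<k}. x 1 l = 0) \<and>
     (\<forall>i\<in>{1..n}. y i (k + 1) = 0) \<and>
     (\<forall>i\<in>{2..n}. \<forall>l\<in>{1..k}. x i l = x (i - 1) l - y (i - 1) l + y (i - 1) (l + 1))"

definition innerLP ::
    "nat \<Rightarrow> nat \<Rightarrow> (nat \<Rightarrow> real) \<Rightarrow> nat \<Rightarrow> (nat \<Rightarrow> nat \<Rightarrow> real) \<Rightarrow> real" where
  "innerLP k n Q m G = Sup {\<theta>. \<exists>x y. innerLP_feasible k n Q m G \<theta> x y}"

definition innerLP_DP_Proph :: "nat \<Rightarrow> nat \<Rightarrow> nat \<Rightarrow> (nat \<Rightarrow> nat \<Rightarrow> real) \<Rightarrow> real" where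
  "innerLP_DP_Proph k n m G = innerLP k n (Q_Proph k n G) m G"

definition innerLP_DP_ExAnte :: "nat \<Rightarrow> nat \<Rightarrow> nat \<Rightarrow> (nat \<Rightarrow> nat \<Rightarrow> real) \<Rightarrow> real" where
  "innerLP_DP_ExAnte k n m G = innerLP k n (Q_ExAnte k n G) m G"

end

theory Submission
  imports Defs
begin

text \<open>
  Put \<open>w j = r j - r (j + 1)\<close>, with \<open>r (m + 1) = 0\<close>. Both benchmarks are the linear functional
  \<open>\<Sum>j. w j * Q j\<close>, because the value of a set of agents is \<open>\<Sum>j. w j * (number of them of type \<le> j)\<close>.
  Likewise \<open>DP\<close> is the maximum of \<open>\<Sum>j. w j * (row j of the LP)\<close> over the flows \<open>(x, y)\<close>: the
  slot-and-acceptance probabilities of a policy form such a flow, and conversely backward induction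
  bounds every flow by the value of the greedy policy. Hence a feasible \<open>\<theta>\<close> is a lower bound for the
  ratio of every instance with type distribution \<open>G\<close>. Conversely, if \<open>\<theta>\<close> exceeds the LP value, no flow
  has all its rows above \<open>\<theta> * Q\<close>, and the separating weights \<open>w\<close> define valuations for which
  \<open>DP \<le> \<theta> * benchmark\<close>.
\<close>

section \<open>Summation and separation lemmas\<close>

lemma sum_diff_pred:
  fixes M :: "nat \<Rightarrow> real"
  shows "(\<Sum>j=1..m. M j - M (j - 1)) = M m - M 0"
  by (induction m) auto

text \<open>Abel summation: expand each \<open>r j\<close> into its tail of weights and exchange the
  sums over the triangle \<open>j \<le> j'\<close>; the inner sum telescopes. It converts a sum over
  types into one over thresholds.\<close>

lemma sum_by_parts:
  fixes r w M :: "nat \<Rightarrow> real"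
  assumes "M 0 = 0" and "\<And>j. j \<in> {1..m} \<Longrightarrow> r j = (\<Sum>j'=j..m. w j')"
  shows "(\<Sum>j=1..m. r j * (M j - M (j - 1))) = (\<Sum>j=1..m. w j * M j)"
proof -
  have "(\<Sum>j=1..m. r j * (M j - M (j - 1))) = (\<Sum>j=1..m. \<Sum>j'=j..m. w j' * (M j - M (j - 1)))"
    by (intro sum.cong refl) (simp add: assms(2) sum_distrib_right)
  also have "\<dots> = (\<Sum>j'=1..m. \<Sum>j=1..j'. w j' * (M j - M (j - 1)))"
    unfolding sum.Sigma[OF finite_atLeastAtMost ballI[OF finite_atLeastAtMost]]
    by (rule sum.reindex_bij_witness[of _ "\<lambda>(a, b). (b, a)" "\<lambda>(a, b). (b, a)"]) auto
  also have "\<dots> = (\<Sum>j=1..m. w j * M j)"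
    by (simp only: sum_diff_pred assms(1) diff_0_right flip: sum_distrib_left)
  finally show ?thesis .
qed

text \<open>Picking elements of smallest \<open>t\<close> one at a time, \<open>k\<close> times or
  until none is left, is optimal for every threshold \<open>j\<close> at once. A single
  \<open>S\<close> serving all \<open>j\<close> is what allows the prophet's maximum to be split by
  threshold.\<close>

lemma ex_subset_minimizing:
  fixes t :: "'a \<Rightarrow> nat"
  assumes "finite X"
  shows "\<exists>S\<subseteq>X. card S \<le> k \<and> (\<forall>j. card {i\<in>S. t i \<le> j} = min (card {i\<in>X. t i \<le> j}) k)"
  using assms
proof (induction k arbitrary: X)
  case 0
  show ?case by (rule exI[of _ "{}"]) auto
next
  case (Suc k)
  show ?case
  proof (cases "X = {}")
    case True
    then show ?thesis by auto
  next
    case False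
    define a where "a = arg_min_on t X"
    have a: "a \<in> X" "\<And>i. i \<in> X \<Longrightarrow> t a \<le> t i"
      unfolding a_def using False Suc.prems
      by (auto intro: arg_min_if_finite(1) simp: arg_min_least)
    obtain S where S: "S \<subseteq> X - {a}" "card S \<le> k"
      "\<And>j. card {i\<in>S. t i \<le> j} = min (card {i\<in>X - {a}. t i \<le> j}) k"
      using Suc.IH[of "X - {a}"] Suc.prems by auto
    have fin: "finite S" using S(1) Suc.prems by (meson finite_Diff finite_subset)
    have "card {i\<in>insert a S. t i \<le> j} = min (card {i\<in>X. t i \<le> j}) (Suc k)" for j
    proof (cases "t a \<le> j")
      case True
      have "{i\<in>insert a S. t i \<le> j} = insert a {i\<in>S. t i \<le> j}"
        "{i\<in>X. t i \<le> j} = insert a {i\<in>X - {a}. t i \<le> j}" using True a(1) by auto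
      then show ?thesis using S fin Suc.prems by (auto simp: card_insert_if)
    next
      case False
      then have "{i\<in>insert a S. t i \<le> j} = {}" "{i\<in>X. t i \<le> j} = {}"
        using a(2) S(1) by force+
      then show ?thesis by (simp only: card.empty min_0L)
    qed
    moreover have "insert a S \<subseteq> X" "card (insert a S) \<le> Suc k"
      using S(1,2) a(1) fin by (auto simp: card_insert_if)
    ultimately show ?thesis by blast
  qed
qed

text \<open>
  The weights are the negative parts of an approximate minimizer of the squared distance to the
  nonnegative orthant; working with an approximate minimizer avoids any compactness of \<open>K\<close>.
\<close>

lemma ex_separating_weights:
  fixes K :: "('a \<Rightarrow> real) set"
  assumes J: "finite J" and "K \<noteq> {}"
    and conv: "\<And>u v t. u \<in> K \<Longrightarrow> v \<in> K \<Longrightarrow> 0 \<le> t \<Longrightarrow> t \<le> 1 \<Longrightarrow>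
      \<exists>z\<in>K. \<forall>j\<in>J. (1 - t) * u j + t * v j \<le> z j"
    and bound: "\<And>v j. v \<in> K \<Longrightarrow> j \<in> J \<Longrightarrow> \<bar>v j\<bar> \<le> B"
    and neg: "\<And>v. v \<in> K \<Longrightarrow> \<exists>j\<in>J. v j \<le> - d" and d: "d > 0"
  shows "\<exists>w. (\<forall>j\<in>J. 0 \<le> w j) \<and> (\<exists>j\<in>J. 0 < w j) \<and> (\<forall>v\<in>K. (\<Sum>j\<in>J. w j * v j) \<le> 0)"
proof -
  define \<Phi> where "\<Phi> v = (\<Sum>j\<in>J. (min 0 (v j))\<^sup>2)" for v :: "'a \<Rightarrow> real"
  define M where "M = real (card J) * (2 * B)\<^sup>2"
  \<comment> \<open>The step length makes the second-order error \<open>t\<^sup>2 * M\<close> of a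
    move from \<open>u\<close> towards \<open>v\<close> at most
    \<open>t * d\<^sup>2\<close>.\<close>
  define t where "t = d\<^sup>2 / (M + d\<^sup>2)"
  have M: "M \<ge> 0" by (simp add: M_def)
  have t: "0 < t" "t \<le> 1" "t * M \<le> d\<^sup>2"
    using M d by (auto simp: t_def field_simps add_nonneg_pos)
  have \<Phi>_ge: "d\<^sup>2 \<le> \<Phi> v" if v: "v \<in> K" for v
  proof -
    obtain j where j: "j \<in> J" "v j \<le> - d" using neg[OF v] by blast
    have "d\<^sup>2 \<le> (- min 0 (v j))\<^sup>2" using j d by (intro power_mono) auto
    also have "\<dots> \<le> \<Phi> v" unfolding \<Phi>_def power2_minus using j J by (intro member_le_sum) auto
    finally show ?thesis .
  qed
  have bdd: "bdd_below (\<Phi> ` K)" using \<Phi>_ge by (intro bdd_belowI2)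
  \<comment> \<open>The slack \<open>t * d\<^sup>2\<close> and the second-order error together cost
    at most \<open>2 * t * d\<^sup>2\<close>, which the term \<open>2 * t * \<Phi> u\<close> below
    pays for.\<close>
  have "(INF v\<in>K. \<Phi> v) < (INF v\<in>K. \<Phi> v) + t * d\<^sup>2" using t d by simp
  then obtain u where u: "u \<in> K" "\<Phi> u < (INF v\<in>K. \<Phi> v) + t * d\<^sup>2"
    using cINF_less_iff[OF \<open>K \<noteq> {}\<close> bdd] by blast
  define w where "w j = - min 0 (u j)" for j
  have "(\<Sum>j\<in>J. w j * v j) \<le> 0" if v: "v \<in> K" for v
  proof -
    obtain z where z: "z \<in> K" "\<And>j. j \<in> J \<Longrightarrow> (1 - t) * u j + t * v j \<le> z j"
      using conv[OF u(1) v, of t] t by auto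
    \<comment> \<open>Where \<open>z j\<close> is negative it lies above
      \<open>min 0 (u j) + t * (v j - u j)\<close>, so its square is smaller. Expanding that square
      uses \<open>w j * u j = - (w j)\<^sup>2\<close>, as \<open>w j\<close> vanishes unless
      \<open>u j < 0\<close>.\<close>
    have 1: "(min 0 (z j))\<^sup>2 \<le> (w j)\<^sup>2 - 2 * t * (w j * v j) - 2 * t * (w j)\<^sup>2 + t\<^sup>2 * (2 * B)\<^sup>2"
      if j: "j \<in> J" for j
    proof -
      have "(min 0 (z j))\<^sup>2 \<le> (min 0 (u j) + t * (v j - u j))\<^sup>2"
      proof (cases "z j \<ge> 0")
        case False
        have "u j + t * (v j - u j) \<le> z j" using z(2)[OF j] by (simp add: algebra_simps)
        then have "- z j \<le> - (min 0 (u j) + t * (v j - u j))" by linarith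
        then have "(- z j)\<^sup>2 \<le> (- (min 0 (u j) + t * (v j - u j)))\<^sup>2"
          using False by (intro power_mono) auto
        then show ?thesis using False unfolding power2_minus by simp
      qed simp
      also have "\<dots> = (w j)\<^sup>2 - 2 * t * (w j * v j) - 2 * t * (w j)\<^sup>2 + t\<^sup>2 * (v j - u j)\<^sup>2"
        by (cases "u j \<ge> 0") (simp_all add: w_def power2_eq_square algebra_simps)
      also have "(v j - u j)\<^sup>2 \<le> (2 * B)\<^sup>2"
      proof (rule power2_le_iff_abs_le[THEN iffD2])
        show "0 \<le> 2 * B" "\<bar>v j - u j\<bar> \<le> 2 * B" using bound[OF v j] bound[OF u(1) j] by linarith+
      qed
      finally show ?thesis by (simp add: mult_left_mono)
    qed
    have \<Phi>u: "\<Phi> u = (\<Sum>j\<in>J. (w j)\<^sup>2)" by (simp add: \<Phi>_def w_def)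
    have "\<Phi> u < \<Phi> z + t * d\<^sup>2" using u(2) cINF_lower[OF bdd z(1)] by linarith
    moreover have "\<Phi> z \<le> \<Phi> u - 2 * t * (\<Sum>j\<in>J. w j * v j) - 2 * t * \<Phi> u + t\<^sup>2 * M"
    proof -
      have "\<Phi> z \<le> (\<Sum>j\<in>J. (w j)\<^sup>2 - 2 * t * (w j * v j) - 2 * t * (w j)\<^sup>2 + t\<^sup>2 * (2 * B)\<^sup>2)"
        unfolding \<Phi>_def by (intro sum_mono 1)
      then show ?thesis
        unfolding \<Phi>u M_def by (simp add: sum.distrib sum_subtractf mult.left_commute[of "t\<^sup>2"] flip: sum_distrib_left)
    qed
    moreover have "t\<^sup>2 * M \<le> t * d\<^sup>2" using t by (simp add: power2_eq_square mult.assoc mult_left_mono)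
    moreover have "t * d\<^sup>2 \<le> t * \<Phi> u" using t \<Phi>_ge[OF u(1)] by simp
    ultimately have "t * (\<Sum>j\<in>J. w j * v j) < 0" by linarith
    then show ?thesis using t(1) by (simp add: mult_less_0_iff)
  qed
  moreover have "\<exists>j\<in>J. 0 < w j" using neg[OF u(1)] d by (force simp: w_def)
  moreover have "\<forall>j\<in>J. 0 \<le> w j" by (simp add: w_def)
  ultimately show ?thesis by blast
qed

section \<open>Expectations over independent coordinates\<close>

lemma expectation_pair_pmf_finite:
  fixes f :: "'a \<times> 'b \<Rightarrow> real"
  assumes "finite (set_pmf p)" "finite (set_pmf q)"
  shows "measure_pmf.expectation (pair_pmf p q) f =
    measure_pmf.expectation q (\<lambda>y. measure_pmf.expectation p (\<lambda>x. f (x, y)))"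
proof -
  have "measure_pmf.expectation (pair_pmf p q) f =
      (\<Sum>(x, y)\<in>set_pmf p \<times> set_pmf q. f (x, y) * (pmf p x * pmf q y))"
    by (subst integral_measure_pmf_real[of "set_pmf p \<times> set_pmf q"])
      (use assms in \<open>auto simp: pmf_pair intro!: sum.cong\<close>)
  also have "\<dots> = (\<Sum>y\<in>set_pmf q. \<Sum>x\<in>set_pmf p. f (x, y) * (pmf p x * pmf q y))"
    by (subst sum.swap) (simp add: sum.cartesian_product)
  also have "\<dots> = measure_pmf.expectation q (\<lambda>y. measure_pmf.expectation p (\<lambda>x. f (x, y)))"
    by (subst integral_measure_pmf_real[of "set_pmf q"],
        use assms in \<open>auto intro!: sum.cong simp: integral_measure_pmf_real[of "set_pmf p"] sum_distrib_right sum_distrib_left mult_ac\<close>)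
  finally show ?thesis .
qed

lemma finite_set_Pi_pmf:
  assumes "finite I" "\<And>i. i \<in> I \<Longrightarrow> finite (set_pmf (p i))"
  shows "finite (set_pmf (Pi_pmf I d p))"
  unfolding set_Pi_pmf[OF assms(1)] using assms by (intro finite_PiE_dflt) auto

text \<open>Independence: \<open>F t\<close> does not read coordinate \<open>i\<close>, so after
  splitting that coordinate off the product it can be averaged out first. Online decisions enter
  through this: what happens before agent \<open>i\<close> is independent of that agent's
  type.\<close>

lemma expectation_Pi_pmf_coordinate:
  fixes F :: "('a \<Rightarrow> 'b) \<Rightarrow> 'b \<Rightarrow> real"
  assumes I: "finite I" "i \<in> I" and fin: "\<And>i. i \<in> I \<Longrightarrow> finite (set_pmf (p i))"
    and F: "\<And>t a b. F (t(i := a)) b = F t b"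
  shows "measure_pmf.expectation (Pi_pmf I d p) (\<lambda>t. F t (t i)) =
    measure_pmf.expectation (Pi_pmf I d p) (\<lambda>t. measure_pmf.expectation (p i) (F t))"
proof -
  have *: "Pi_pmf I d p = map_pmf (\<lambda>(y, f). f(i := y)) (pair_pmf (p i) (Pi_pmf (I - {i}) d p))"
    using Pi_pmf_insert[of "I - {i}" i d p] I by (simp add: insert_absorb)
  have fin': "finite (set_pmf (Pi_pmf (I - {i}) d p))" using I fin by (intro finite_set_Pi_pmf) auto
  have F': "F (t(i := a)) = F t" for t a using F by blast
  show ?thesis unfolding *
    by (simp add: case_prod_unfold F' expectation_pair_pmf_finite[OF fin[OF I(2)] fin'])
qed

section \<open>Flows of the inner LP\<close>

text \<open>The LP constraints that do not mention \<open>\<theta>\<close>. Read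
  \<open>x i l\<close> as the probability that agent \<open>i\<close> finds \<open>l\<close> free
  slots and \<open>y i l\<close> as the probability that the agent is moreover accepted.\<close>

definition lp_flow :: "nat \<Rightarrow> nat \<Rightarrow> (nat \<Rightarrow> nat \<Rightarrow> real) \<Rightarrow> (nat \<Rightarrow> nat \<Rightarrow> real) \<Rightarrow> bool" where
  "lp_flow k n x y \<longleftrightarrow>
     (\<forall>i\<in>{1..n}. \<forall>l\<in>{1..k}. 0 \<le> y i l \<and> y i l \<le> x i l) \<and>
     x 1 k = 1 \<and> (\<forall>l\<in>{1..<k}. x 1 l = 0) \<and>
     (\<forall>i\<in>{1..n}. y i (k + 1) = 0) \<and>
     (\<forall>i\<in>{2..n}. \<forall>l\<in>{1..k}. x i l = x (i - 1) l - y (i - 1) l + y (i - 1) (l + 1))"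

text \<open>The right-hand side of constraint \<open>j\<close>: the accepted mass of types up to
  \<open>j\<close> when the acceptance budget \<open>y i l\<close> is spent on the best types
  first.\<close>

definition lp_row ::
    "nat \<Rightarrow> nat \<Rightarrow> (nat \<Rightarrow> nat \<Rightarrow> real) \<Rightarrow> (nat \<Rightarrow> nat \<Rightarrow> real) \<Rightarrow> (nat \<Rightarrow> nat \<Rightarrow> real) \<Rightarrow> nat \<Rightarrow> real" where
  "lp_row k n G x y j = (\<Sum>i=1..n. \<Sum>l=1..k. min (y i l) (G i j * x i l))"

lemma innerLP_feasible_iff:
  "innerLP_feasible k n Q m G \<theta> x y \<longleftrightarrow>
     (\<forall>j\<in>{1..m}. \<theta> * Q j \<le> lp_row k n G x y j) \<and> lp_flow k n x y"
  by (auto simp: innerLP_feasible_def lp_flow_def lp_row_def)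

text \<open>This is the policy that rejects everyone.\<close>

lemma lp_flow_trivial: "lp_flow k n (\<lambda>i l. of_bool (l = k)) (\<lambda>i l. 0)"
  by (auto simp: lp_flow_def)

text \<open>The unit of mass at \<open>k\<close> slots only moves downwards, and the flow
  \<open>y i 1\<close> leaves the system because the state with no free slot is not tracked.\<close>

lemma lp_flow_sum_le_1:
  assumes "lp_flow k n x y" "k \<ge> 1" "i \<in> {1..n}"
  shows "(\<Sum>l=1..k. x i l) \<le> 1"
proof -
  have "1 \<le> i" "i \<le> n" using assms(3) by auto
  then show ?thesis
  proof (induction i rule: dec_induct)
    case base
    have "(\<Sum>l=1..k. x 1 l) = (\<Sum>l\<in>{k}. x 1 l)"
      using assms(1,2) by (intro sum.mono_neutral_right) (auto simp: lp_flow_def)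
    then show ?case using assms(1) by (simp add: lp_flow_def)
  next
    case (step i)
    have tel: "(\<Sum>l=1..k. y i l) = (\<Sum>l=1..k. y i (l + 1)) + y i 1 - y i (k + 1)"
      by (induction k) auto
    have "(\<Sum>l=1..k. x (Suc i) l) = (\<Sum>l=1..k. x i l - y i l + y i (l + 1))"
      using assms(1) step by (intro sum.cong refl) (auto simp: lp_flow_def dest!: bspec[of _ _ "Suc i"])
    also have "\<dots> = (\<Sum>l=1..k. x i l) - y i 1 + y i (k + 1)"
      using tel by (simp add: sum.distrib sum_subtractf)
    also have "\<dots> \<le> (\<Sum>l=1..k. x i l)" using assms(1,2) step by (auto simp: lp_flow_def)
    finally show ?case using step by auto
  qed
qed

lemma weighted_lp_rows:
  "(\<Sum>j=1..m. w j * lp_row k n G x y j) =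
    (\<Sum>i=1..n. \<Sum>l=1..k. \<Sum>j=1..m. w j * min (y i l) (G i j * x i l))"
proof -
  have "(\<Sum>j\<in>J. w j * (\<Sum>i\<in>I. \<Sum>l\<in>L. f i l j)) = (\<Sum>i\<in>I. \<Sum>l\<in>L. \<Sum>j\<in>J. w j * f i l j)"
    for J I L and f :: "nat \<Rightarrow> nat \<Rightarrow> nat \<Rightarrow> real"
    by (simp only: sum_distrib_left sum.swap[where A = J and B = I] sum.swap[where A = J and B = L])
  then show ?thesis by (simp only: lp_row_def)
qed

lemma lp_row_nonneg:
  assumes "lp_flow k n x y" "\<And>i. i \<in> {1..n} \<Longrightarrow> 0 \<le> G i j"
  shows "0 \<le> lp_row k n G x y j"
  unfolding lp_row_def
proof (intro sum_nonneg)
  fix i l assume il: "i \<in> {1..n}" "l \<in> {1..k}"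
  then have "0 \<le> y i l" "y i l \<le> x i l" using assms(1) by (auto simp: lp_flow_def)
  then show "0 \<le> min (y i l) (G i j * x i l)" using assms(2)[OF il(1)] by simp
qed

lemma lp_row_le:
  assumes "lp_flow k n x y" "k \<ge> 1"
  shows "lp_row k n G x y j \<le> n"
proof -
  have "lp_row k n G x y j \<le> (\<Sum>i=1..n. 1)"
    unfolding lp_row_def
  proof (rule sum_mono)
    fix i assume i: "i \<in> {1..n}"
    have "(\<Sum>l=1..k. min (y i l) (G i j * x i l)) \<le> (\<Sum>l=1..k. x i l)"
      using assms i by (intro sum_mono) (force simp: lp_flow_def min_le_iff_disj)
    then show "(\<Sum>l=1..k. min (y i l) (G i j * x i l)) \<le> 1"
      using lp_flow_sum_le_1[OF assms i] by linarith
  qed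
  then show ?thesis by simp
qed

lemma lp_flow_convex:
  assumes "lp_flow k n x y" "lp_flow k n x' y'" "0 \<le> t" "t \<le> 1"
  shows "lp_flow k n (\<lambda>i l. (1 - t) * x i l + t * x' i l) (\<lambda>i l. (1 - t) * y i l + t * y' i l)"
  unfolding lp_flow_def
proof (intro conjI ballI)
  fix i l assume "i \<in> {1..n}" "l \<in> {1..k}"
  then have "0 \<le> y i l" "0 \<le> y' i l" "y i l \<le> x i l" "y' i l \<le> x' i l"
    using assms(1,2) unfolding lp_flow_def by blast+
  then show "0 \<le> (1 - t) * y i l + t * y' i l"
    "(1 - t) * y i l + t * y' i l \<le> (1 - t) * x i l + t * x' i l"
    using assms(3,4) by (simp_all add: add_mono mult_left_mono)
next
  fix i l assume "i \<in> {2..n}" "l \<in> {1..k}"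
  then have eqs: "x i l = x (i - 1) l - y (i - 1) l + y (i - 1) (l + 1)"
    "x' i l = x' (i - 1) l - y' (i - 1) l + y' (i - 1) (l + 1)"
    using assms(1,2) unfolding lp_flow_def by blast+
  show "(1 - t) * x i l + t * x' i l = (1 - t) * x (i - 1) l + t * x' (i - 1) l -
      ((1 - t) * y (i - 1) l + t * y' (i - 1) l) + ((1 - t) * y (i - 1) (l + 1) + t * y' (i - 1) (l + 1))"
    unfolding eqs by (simp add: algebra_simps)
qed (use assms(1,2) in \<open>auto simp: lp_flow_def algebra_simps\<close>)

text \<open>A minimum of two linear functions is concave. Rows are therefore not linear in the flow,
  which is why \<open>ex_separating_weights\<close> asks only for a point dominating the convex
  combination.\<close>

lemma lp_row_concave:
  assumes "0 \<le> t" "t \<le> 1"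
  shows "(1 - t) * lp_row k n G x y j + t * lp_row k n G x' y' j \<le>
    lp_row k n G (\<lambda>i l. (1 - t) * x i l + t * x' i l) (\<lambda>i l. (1 - t) * y i l + t * y' i l) j"
proof -
  have min_concave: "(1 - t) * min a b + t * min a' b' \<le> min ((1 - t) * a + t * a') ((1 - t) * b + t * b')"
    for a b a' b' :: real
    using assms by (auto intro!: add_mono mult_left_mono)
  have "(1 - t) * min (y i l) (G i j * x i l) + t * min (y' i l) (G i j * x' i l)
    \<le> min ((1 - t) * y i l + t * y' i l) (G i j * ((1 - t) * x i l + t * x' i l))" for i l
  proof -
    have "(1 - t) * (G i j * x i l) + t * (G i j * x' i l) = G i j * ((1 - t) * x i l + t * x' i l)"
      by (simp add: algebra_simps)
    then show ?thesis by (metis min_concave)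
  qed
  then show ?thesis
    unfolding lp_row_def sum_distrib_left sum.distrib[symmetric] by (intro sum_mono)
qed

section \<open>Policies and flows on a weighted instance\<close>

text \<open>Nonnegative weights \<open>w\<close> with tail sums \<open>r\<close> encode exactly the
  nonincreasing nonnegative valuations. Keeping \<open>w\<close> and \<open>G\<close> as parameters
  allows entry both from an instance and from a type distribution with weights.\<close>

locale weighted_instance =
  fixes n m :: nat and r :: "nat \<Rightarrow> real" and p :: "nat \<Rightarrow> nat pmf"
    and w :: "nat \<Rightarrow> real" and G :: "nat \<Rightarrow> nat \<Rightarrow> real"
  assumes m_pos: "m \<ge> 1"
    and support: "i \<in> {1..n} \<Longrightarrow> set_pmf (p i) \<subseteq> {1..m}"
    and w_nonneg: "j \<in> {1..m} \<Longrightarrow> 0 \<le> w j"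
    and r_eq: "j \<in> {1..m} \<Longrightarrow> r j = (\<Sum>j'=j..m. w j')"
    and G_eq: "i \<in> {1..n} \<Longrightarrow> j \<le> m \<Longrightarrow> G i j = (\<Sum>j'=1..j. pmf (p i) j')"
begin

lemma r_nonneg: "j \<in> {1..m} \<Longrightarrow> 0 \<le> r j"
  unfolding r_eq by (intro sum_nonneg w_nonneg) auto

lemma r_eq_indicator: "j \<in> {1..m} \<Longrightarrow> r j = (\<Sum>j'=1..m. w j' * of_bool (j \<le> j'))"
  unfolding r_eq by (intro sum.mono_neutral_cong_left) auto

lemma finite_support: "i \<in> {1..n} \<Longrightarrow> finite (set_pmf (p i))"
  using support finite_subset by blast

lemma expectation_type:
  fixes h :: "nat \<Rightarrow> real"
  assumes "i \<in> {1..n}"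
  shows "measure_pmf.expectation (p i) h = (\<Sum>j=1..m. h j * pmf (p i) j)"
  using support[OF assms] by (intro integral_measure_pmf_real) auto

lemma sum_pmf: "i \<in> {1..n} \<Longrightarrow> (\<Sum>j=1..m. pmf (p i) j) = 1"
  using support by (intro sum_pmf_eq_1) auto

lemma G_0: "i \<in> {1..n} \<Longrightarrow> G i 0 = 0"
  by (simp add: G_eq)

lemma G_m: "i \<in> {1..n} \<Longrightarrow> G i m = 1"
  by (simp add: G_eq sum_pmf del: One_nat_def)

lemma G_diff: "i \<in> {1..n} \<Longrightarrow> j \<in> {1..m} \<Longrightarrow> G i j - G i (j - 1) = pmf (p i) j"
  by (cases j) (auto simp: G_eq)

lemma finite_types: "finite (set_pmf (types_pmf n p))"
  unfolding types_pmf_def by (intro finite_set_Pi_pmf) (auto simp: finite_support)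

lemma types_range: "t \<in> set_pmf (types_pmf n p) \<Longrightarrow> i \<in> {1..n} \<Longrightarrow> t i \<in> {1..m}"
  unfolding types_pmf_def using support by (fastforce simp: set_Pi_pmf PiE_dflt_def)

lemma integrable_types: "integrable (measure_pmf (types_pmf n p)) f" for f :: "_ \<Rightarrow> real"
  by (rule integrable_measure_pmf_finite[OF finite_types])

lemma expectation_types_coordinate:
  fixes F :: "(nat \<Rightarrow> nat) \<Rightarrow> nat \<Rightarrow> real"
  assumes "i \<in> {1..n}" "\<And>t a b. F (t(i := a)) b = F t b"
  shows "measure_pmf.expectation (types_pmf n p) (\<lambda>t. F t (t i)) =
    measure_pmf.expectation (types_pmf n p) (\<lambda>t. \<Sum>j=1..m. F t j * pmf (p i) j)"
  unfolding types_pmf_def expectation_type[OF assms(1), symmetric]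
  using assms finite_support by (intro expectation_Pi_pmf_coordinate) auto

text \<open>
  Types are served in order: type \<open>j\<close> receives \<open>min y (G i j * x) - min y (G i (j - 1) * x)\<close>, at most
  its total mass \<open>x * pmf (p i) j\<close>, so the claim holds type by type.
\<close>

lemma quantile_gain_le:
  assumes i: "i \<in> {1..n}" and xy: "0 \<le> y" "y \<le> x"
  shows "(\<Sum>j=1..m. w j * min y (G i j * x)) - \<delta> * y \<le> x * (\<Sum>j=1..m. max 0 (r j - \<delta>) * pmf (p i) j)"
proof -
  define M where "M j = min y (G i j * x)" for j
  have M0: "M 0 = 0" and Mm: "M m = y" using xy by (simp_all add: M_def G_0[OF i] G_m[OF i])
  have tel: "(\<Sum>j=1..m. M j - M (j - 1)) = y" by (simp only: sum_diff_pred M0 Mm diff_0_right)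
  \<comment> \<open>The increments of \<open>M\<close> add up to \<open>y\<close>, so the charge
    \<open>\<delta> * y\<close> can also be distributed over the types.\<close>
  have "(\<Sum>j=1..m. w j * M j) - \<delta> * y = (\<Sum>j=1..m. (r j - \<delta>) * (M j - M (j - 1)))"
    using sum_by_parts[of M m r w, OF M0 r_eq] tel
    by (simp add: left_diff_distrib sum_subtractf flip: sum_distrib_left)
  also have "\<dots> \<le> (\<Sum>j=1..m. max 0 (r j - \<delta>) * (x * pmf (p i) j))"
  proof (rule sum_mono)
    fix j assume j: "j \<in> {1..m}"
    have eq: "G i j * x = G i (j - 1) * x + x * pmf (p i) j"
      unfolding G_diff[OF i j, symmetric] by (simp add: algebra_simps)
    have "0 \<le> x * pmf (p i) j" using xy by simp
    then have "0 \<le> M j - M (j - 1)" "M j - M (j - 1) \<le> x * pmf (p i) j"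
      unfolding M_def eq by linarith+
    then show "(r j - \<delta>) * (M j - M (j - 1)) \<le> max 0 (r j - \<delta>) * (x * pmf (p i) j)"
      by (intro order_trans[OF mult_right_mono mult_left_mono]) auto
  qed
  finally show ?thesis by (simp add: M_def sum_distrib_left mult_ac)
qed

text \<open>
  \<open>togo s l\<close> is the optimal expected value when \<open>s\<close> agents and \<open>l\<close> slots remain; the next agent is
  \<open>n - s + 1\<close>.
\<close>

primrec togo :: "nat \<Rightarrow> nat \<Rightarrow> real" where
  "togo 0 l = 0"
| "togo (Suc s) l =
     (\<Sum>j=1..m. max (togo s l) (if l = 0 then 0 else r j + togo s (l - 1)) * pmf (p (n - s)) j)"

text \<open>The index is now the arriving agent, as in flows and policies; \<open>togo\<close>
  counts remaining agents so as to be primitive recursive.\<close>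

definition val :: "nat \<Rightarrow> nat \<Rightarrow> real" where
  "val i l = togo (n + 1 - i) l"

lemma togo_0: "togo s 0 = 0"
  by (induction s) auto

lemma val_0: "val i 0 = 0"
  by (simp add: val_def togo_0)

lemma val_last: "val (Suc n) l = 0"
  by (simp add: val_def)

lemma val_rec:
  assumes "i \<in> {1..n}"
  shows "val i l = (\<Sum>j=1..m. max (val (Suc i) l) (if l = 0 then 0 else r j + val (Suc i) (l - 1)) * pmf (p i) j)"
proof -
  have "n + 1 - i = Suc (n - i)" "n - (n - i) = i" using assms by auto
  then show ?thesis by (simp add: val_def cong: if_cong)
qed

text \<open>The Bellman equation in terms of the opportunity cost of a slot, by
  \<open>max a (r + b) = a + max 0 (r - (a - b))\<close>. The last sum is the bound of
  \<open>quantile_gain_le\<close> per unit of \<open>x\<close>.\<close>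

lemma val_eq_gain:
  assumes "i \<in> {1..n}" "l \<ge> 1"
  shows "val i l = val (Suc i) l +
    (\<Sum>j=1..m. max 0 (r j - (val (Suc i) l - val (Suc i) (l - 1))) * pmf (p i) j)"
proof -
  have "val i l = (\<Sum>j=1..m. val (Suc i) l * pmf (p i) j +
      max 0 (r j - (val (Suc i) l - val (Suc i) (l - 1))) * pmf (p i) j)"
    unfolding val_rec[OF assms(1)] using assms(2)
    by (intro sum.cong refl) (auto simp: max_def algebra_simps)
  then show ?thesis using sum_pmf[OF assms(1)] by (simp add: sum.distrib flip: sum_distrib_left)
qed

text \<open>A potential argument: in each round the weighted gain of the flow is at most the drop in
  optimal remaining value.\<close>

lemma lp_rows_le_val:
  assumes flow: "lp_flow k n x y" and k: "k \<ge> 1" and n: "n \<ge> 1"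
  shows "(\<Sum>j=1..m. w j * lp_row k n G x y j) \<le> val 1 k"
proof -
  define gain where "gain i = (\<Sum>l=1..k. \<Sum>j=1..m. w j * min (y i l) (G i j * x i l))" for i
  \<comment> \<open>\<open>\<Phi> i\<close> averages the optimal remaining value over the slot
    distribution \<open>x i\<close>; \<open>\<Psi> i\<close> is the average once agent
    \<open>i\<close> has shifted the mass \<open>y i l\<close> from \<open>l\<close> to
    \<open>l - 1\<close> slots.\<close>
  define \<Phi> where "\<Phi> i = (\<Sum>l=1..k. x i l * val i l)" for i
  define \<Psi> where "\<Psi> i = (\<Sum>l=1..k. (x i l - y i l) * val (Suc i) l + y i l * val (Suc i) (l - 1))" for i
  have step: "gain i + \<Psi> i \<le> \<Phi> i" if i: "i \<in> {1..n}" for i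
    unfolding gain_def \<Phi>_def \<Psi>_def sum.distrib[symmetric]
  proof (rule sum_mono)
    fix l assume l: "l \<in> {1..k}"
    have "0 \<le> y i l" "y i l \<le> x i l" using flow i l by (auto simp: lp_flow_def)
    from quantile_gain_le[OF i this, of "val (Suc i) l - val (Suc i) (l - 1)"]
    show "(\<Sum>j=1..m. w j * min (y i l) (G i j * x i l)) +
        ((x i l - y i l) * val (Suc i) l + y i l * val (Suc i) (l - 1)) \<le> x i l * val i l"
      using val_eq_gain[OF i, of l] l by (simp add: algebra_simps)
  qed
  have \<Psi>: "\<Psi> i = \<Phi> (Suc i)" if i: "i \<in> {1..<n}" for i
  proof -
    \<comment> \<open>Shifting \<open>l\<close> by one loses nothing at the lower end because
      \<open>val (Suc i) 0 = 0\<close>, nor at the upper end because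
      \<open>y i (k + 1) = 0\<close>.\<close>
    have shift: "(\<Sum>l=1..k. y i l * val (Suc i) (l - 1)) + y i (k + 1) * val (Suc i) k =
        (\<Sum>l=1..k. y i (l + 1) * val (Suc i) l)"
      by (induction k) (auto simp: val_0)
    have y: "y i (k + 1) = 0" using flow i by (auto simp: lp_flow_def)
    have "\<Phi> (Suc i) = (\<Sum>l=1..k. (x i l - y i l + y i (l + 1)) * val (Suc i) l)"
      unfolding \<Phi>_def using flow i
      by (intro sum.cong refl) (auto simp: lp_flow_def dest!: bspec[of _ _ "Suc i"])
    also have "\<dots> = \<Psi> i"
      using shift unfolding \<Psi>_def y by (simp add: distrib_right sum.distrib)
    finally show ?thesis ..
  qed
  have "(\<Sum>i'=1..i. gain i') + \<Psi> i \<le> \<Phi> 1" if "1 \<le> i" "i \<le> n" for i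
    using that
  proof (induction i rule: dec_induct)
    case base
    then show ?case using step[of 1] n by simp
  next
    case (step i)
    then show ?case using \<Psi>[of i] \<open>\<And>i. i \<in> {1..n} \<Longrightarrow> gain i + \<Psi> i \<le> \<Phi> i\<close>[of "Suc i"] by simp
  qed
  from this[of n] have "(\<Sum>i=1..n. gain i) \<le> \<Phi> 1" using n by (simp add: \<Psi>_def val_last)
  also have "\<Phi> 1 = (\<Sum>l\<in>{k}. x 1 l * val 1 l)"
    unfolding \<Phi>_def using flow k by (intro sum.mono_neutral_right) (auto simp: lp_flow_def)
  also have "\<dots> = val 1 k" using flow by (simp add: lp_flow_def)
  finally show ?thesis by (simp only: weighted_lp_rows gain_def)
qed

section \<open>The greedy policy attains the backward-induction value\<close>

definition accepts :: "nat \<Rightarrow> nat \<Rightarrow> nat \<Rightarrow> bool" where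
  "accepts i l \<tau> \<longleftrightarrow> l > 0 \<and> val (Suc i) l \<le> r \<tau> + val (Suc i) (l - 1)"

text \<open>The index counts agents already processed, so agent \<open>i\<close> meets
  \<open>slots k t (i - 1)\<close> free slots.\<close>

primrec slots :: "nat \<Rightarrow> (nat \<Rightarrow> nat) \<Rightarrow> nat \<Rightarrow> nat" where
  "slots k t 0 = k"
| "slots k t (Suc i) = slots k t i - of_bool (accepts (Suc i) (slots k t i) (t (Suc i)))"

definition greedy :: "nat \<Rightarrow> (nat \<Rightarrow> nat) \<Rightarrow> nat set" where
  "greedy k t = {i\<in>{1..n}. accepts i (slots k t (i - 1)) (t i)}"

lemma slots_cong: "(\<And>i'. i' \<in> {1..i} \<Longrightarrow> t i' = t' i') \<Longrightarrow> slots k t i = slots k t' i"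
  by (induction i) auto

lemma greedy_Suc:
  assumes "Suc i \<le> n"
  shows "greedy k t \<inter> {1..Suc i} = (if accepts (Suc i) (slots k t i) (t (Suc i))
    then insert (Suc i) (greedy k t \<inter> {1..i}) else greedy k t \<inter> {1..i})"
  using assms by (auto simp: greedy_def le_Suc_eq)

text \<open>Acceptance requires a free slot, so the truncated subtraction in \<open>slots\<close>
  never loses anything. At \<open>i = n\<close> this is the capacity constraint.\<close>

lemma card_greedy: "i \<le> n \<Longrightarrow> card (greedy k t \<inter> {1..i}) + slots k t i = k"
proof (induction i)
  case (Suc i)
  show ?case
    unfolding greedy_Suc[OF Suc.prems] using Suc by (auto simp: accepts_def)
qed simp

lemma greedy_det: "greedy k \<in> det_policies k n"
proof -
  have sub: "greedy k t \<subseteq> {1..n}" for t by (auto simp: greedy_def)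
  then have "greedy k t \<inter> {1..n} = greedy k t" for t by blast
  then have "card (greedy k t) \<le> k" for t using card_greedy[of n k t] by simp
  moreover have "i \<in> greedy k t \<longleftrightarrow> i \<in> greedy k t'"
    if "i \<in> {1..n}" "\<forall>i'\<in>{1..i}. t i' = t' i'" for i t t'
  proof -
    have "slots k t (i - 1) = slots k t' (i - 1)" using that by (intro slots_cong) auto
    then show ?thesis using that by (simp add: greedy_def)
  qed
  ultimately show ?thesis using sub unfolding det_policies_def by blast
qed

text \<open>The collected value plus the optimal remaining value has constant expectation, since the
  greedy decision attains the maximum in the Bellman recursion.\<close>

lemma expectation_greedy:
  "i \<le> n \<Longrightarrow> measure_pmf.expectation (types_pmf n p)
    (\<lambda>t. (\<Sum>i'\<in>greedy k t \<inter> {1..i}. r (t i')) + val (Suc i) (slots k t i)) = val 1 k"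
proof (induction i)
  case (Suc i)
  let ?E = "measure_pmf.expectation (types_pmf n p)"
  let ?S = "\<lambda>t. \<Sum>i'\<in>greedy k t \<inter> {1..i}. r (t i')"
  have i: "Suc i \<in> {1..n}" using Suc.prems by simp
  \<comment> \<open>\<open>F t\<close> sees the profile only through the slots left by the first
    \<open>i\<close> agents, so the type of agent \<open>Suc i\<close> may be averaged
    separately.\<close>
  define F where "F t \<tau> = (let l = slots k t i in max (val (Suc (Suc i)) l)
    (if l = 0 then 0 else r \<tau> + val (Suc (Suc i)) (l - 1)))" for t \<tau>
  have F_upd: "F (t(Suc i := a)) b = F t b" for t a b
    using slots_cong[of i "t(Suc i := a)" t k] by (simp add: F_def)
  have "?E (\<lambda>t. (\<Sum>i'\<in>greedy k t \<inter> {1..Suc i}. r (t i')) + val (Suc (Suc i)) (slots k t (Suc i)))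
      = ?E (\<lambda>t. ?S t + F t (t (Suc i)))"
    unfolding greedy_Suc[OF Suc.prems]
    by (intro arg_cong[of _ _ ?E] ext) (auto simp: F_def accepts_def Let_def max_def val_0)
  also have "\<dots> = ?E ?S + ?E (\<lambda>t. \<Sum>j=1..m. F t j * pmf (p (Suc i)) j)"
    by (simp add: Bochner_Integration.integral_add integrable_types
        expectation_types_coordinate[of _ F, OF i F_upd])
  also have "\<dots> = ?E (\<lambda>t. ?S t + val (Suc i) (slots k t i))"
    by (simp add: Bochner_Integration.integral_add integrable_types F_def Let_def val_rec[OF i])
  finally show ?case using Suc by simp
qed (simp add: measure_pmf.prob_space)

section \<open>From policies to flows, and two-sided bounds on \<open>DP\<close>\<close>

lemma policy_value_return:
  "policy_value n r p (return_pmf A) = measure_pmf.expectation (types_pmf n p) (\<lambda>t. \<Sum>i\<in>A t. r (t i))"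
  by (simp add: policy_value_def pair_return_pmf1)

lemma policy_value_greedy: "policy_value n r p (return_pmf (greedy k)) = val 1 k"
proof -
  have "greedy k t \<inter> {1..n} = greedy k t" for t by (auto simp: greedy_def)
  then show ?thesis
    using expectation_greedy[of n k] by (simp add: policy_value_return val_last)
qed

text \<open>A randomized policy is a mixture of deterministic ones. Its support may be infinite, so
  the averaging is done with nonnegative integrals.\<close>

lemma policy_value_le:
  assumes "\<And>A. A \<in> det_policies k n \<Longrightarrow> policy_value n r p (return_pmf A) \<le> c"
    and D: "D \<in> policies k n"
  shows "policy_value n r p D \<le> c"
proof -
  let ?T = "types_pmf n p"
  let ?f = "\<lambda>(A, t). \<Sum>i\<in>A t. r (t i)"
  have D': "A \<in> det_policies k n" if "A \<in> set_pmf D" for A using D that by (auto simp: policies_def)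
  have nn: "0 \<le> ?f (A, t)" if "A \<in> det_policies k n" "t \<in> set_pmf ?T" for A t
  proof -
    have "A t \<subseteq> {1..n}" using that(1) by (simp add: det_policies_def)
    then have "0 \<le> r (t i)" if "i \<in> A t" for i
      using that types_range[OF \<open>t \<in> set_pmf ?T\<close>] by (intro r_nonneg) blast
    then show ?thesis by (simp add: sum_nonneg)
  qed
  \<comment> \<open>Any policy in the support has nonnegative value, hence \<open>0 \<le> c\<close>,
    which the passage to \<open>ennreal c\<close> and back requires.\<close>
  obtain A0 where A0: "A0 \<in> set_pmf D" using set_pmf_not_empty[of D] by blast
  have "0 \<le> policy_value n r p (return_pmf A0)"
    unfolding policy_value_return using nn[OF D'[OF A0]]
    by (intro integral_nonneg_AE) (auto simp: AE_measure_pmf_iff)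
  then have c: "0 \<le> c" using assms(1)[OF D'[OF A0]] by linarith
  have "policy_value n r p D = enn2real (\<integral>\<^sup>+z. ennreal (?f z) \<partial>pair_pmf D ?T)"
    unfolding policy_value_def
    by (intro integral_eq_nn_integral) (auto simp: AE_measure_pmf_iff intro!: nn[simplified] D')
  moreover have "(\<integral>\<^sup>+z. ennreal (?f z) \<partial>pair_pmf D ?T) = (\<integral>\<^sup>+A. (\<integral>\<^sup>+t. ennreal (?f (A, t)) \<partial>?T) \<partial>D)"
    by (rule nn_integral_pair_pmf')
  moreover have "\<dots> \<le> (\<integral>\<^sup>+A. ennreal c \<partial>D)"
  proof (intro nn_integral_mono_AE, unfold AE_measure_pmf_iff, intro ballI)
    fix A assume A: "A \<in> set_pmf D"
    have "(\<integral>\<^sup>+t. ennreal (?f (A, t)) \<partial>?T) = ennreal (measure_pmf.expectation ?T (\<lambda>t. ?f (A, t)))"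
      using nn[OF D'[OF A]] by (intro nn_integral_eq_integral integrable_types) (auto simp: AE_measure_pmf_iff)
    then show "(\<integral>\<^sup>+t. ennreal (?f (A, t)) \<partial>?T) \<le> ennreal c"
      using assms(1)[OF D'[OF A]] by (simp add: policy_value_return ennreal_leI)
  qed
  ultimately show ?thesis using c by (simp add: enn2real_leI)
qed

text \<open>The slot and acceptance probabilities form a flow. Accepting agent \<open>i\<close> at
  \<open>l\<close> slots with type at most \<open>j\<close> is no likelier than accepting at
  \<open>l\<close> slots, \<open>y i l\<close>, nor than meeting \<open>l\<close> slots with such a
  type, \<open>G i j * x i l\<close> by independence.\<close>

lemma det_policy_flow:
  assumes A: "A \<in> det_policies k n"
  shows "\<exists>x y. lp_flow k n x y \<and>
    policy_value n r p (return_pmf A) \<le> (\<Sum>j=1..m. w j * lp_row k n G x y j)"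
proof -
  let ?E = "measure_pmf.expectation (types_pmf n p)"
  define left where "left i t = k - card (A t \<inter> {1..<i})" for i t
  define x :: "nat \<Rightarrow> nat \<Rightarrow> real" where "x i l = ?E (\<lambda>t. of_bool (left i t = l))" for i l
  define y :: "nat \<Rightarrow> nat \<Rightarrow> real" where "y i l = ?E (\<lambda>t. of_bool (left i t = l \<and> i \<in> A t))" for i l
  have AD: "A t \<subseteq> {1..n}" "card (A t) \<le> k" for t using A by (auto simp: det_policies_def)
  have finA: "finite (A t)" for t using AD(1) finite_subset by blast
  have left_Suc: "left (Suc i) t = left i t - of_bool (i \<in> A t)" if "i \<ge> 1" for i t
  proof -
    have "A t \<inter> {1..<Suc i} = (if i \<in> A t then insert i (A t \<inter> {1..<i}) else A t \<inter> {1..<i})"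
      using that by (auto simp: less_Suc_eq)
    then show ?thesis using finA[of t] by (simp add: left_def)
  qed
  \<comment> \<open>An accepted agent takes one of at most \<open>k\<close> places, so the others
    accepted earlier number fewer than \<open>k\<close>.\<close>
  have left_pos: "left i t \<in> {1..k}" if "i \<in> A t" for i t
  proof -
    have "card (A t \<inter> {1..<i}) < card (A t)" using that finA by (intro psubset_card_mono) auto
    then show ?thesis using AD(2)[of t] by (auto simp: left_def)
  qed
  have flow: "lp_flow k n x y"
    unfolding lp_flow_def
  proof (intro conjI ballI)
    fix i l
    show "0 \<le> y i l" unfolding y_def by (intro integral_nonneg_AE) auto
    show "y i l \<le> x i l" unfolding x_def y_def by (intro integral_mono integrable_types) auto
  next
    show "x 1 k = 1" by (simp add: x_def left_def measure_pmf.prob_space)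
    show "x 1 l = 0" if "l \<in> {1..<k}" for l using that by (simp add: x_def left_def)
    show "y i (k + 1) = 0" for i
    proof -
      have "left i t \<noteq> k + 1" for t by (simp add: left_def)
      then show ?thesis by (simp add: y_def)
    qed
  next
    fix i l assume i: "i \<in> {2..n}" and l: "l \<in> {1..k}"
    obtain i' where i': "i = Suc i'" "i' \<ge> 1" using i by (cases i) auto
    \<comment> \<open>To have \<open>l \<ge> 1\<close> slots after agent \<open>i'\<close>, either
      there were \<open>l\<close> and the agent was rejected, or \<open>l + 1\<close> and the agent
      was accepted.\<close>
    have "of_bool (left i t = l) = (of_bool (left i' t = l) - of_bool (left i' t = l \<and> i' \<in> A t)
        + of_bool (left i' t = l + 1 \<and> i' \<in> A t) :: real)" for t
      using l left_pos[of i' t] by (auto simp: i'(1) left_Suc[OF i'(2)])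
    then show "x i l = x (i - 1) l - y (i - 1) l + y (i - 1) (l + 1)"
      by (simp add: x_def y_def i'(1) integrable_types)
  qed
  have xG: "?E (\<lambda>t. of_bool (left i t = l) * of_bool (t i \<le> j)) = G i j * x i l"
    if i: "i \<in> {1..n}" and j: "j \<le> m" for i l j
  proof -
    have left_upd: "left i (t(i := a)) = left i t" for t a
    proof -
      have "A (t(i := a)) \<inter> {1..<i} = A t \<inter> {1..<i}"
      proof -
        have "i' \<in> A (t(i := a)) \<longleftrightarrow> i' \<in> A t" if "i' \<in> {1..<i}" for i'
        proof -
          have "i' \<in> {1..n}" "\<forall>i''\<in>{1..i'}. (t(i := a)) i'' = t i''" using that i by auto
          then show ?thesis using A unfolding det_policies_def by blast
        qed
        then show ?thesis by blast
      qed
      then show ?thesis by (simp add: left_def)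
    qed
    have "(\<Sum>\<tau>=1..m. of_bool (\<tau> \<le> j) * pmf (p i) \<tau>) = G i j"
      unfolding G_eq[OF i j] using j by (intro sum.mono_neutral_cong_right) auto
    then have "(\<Sum>\<tau>=1..m. of_bool (left i t = l) * of_bool (\<tau> \<le> j) * pmf (p i) \<tau>)
        = G i j * of_bool (left i t = l)" for t
      by (simp add: mult.assoc flip: sum_distrib_left)
    then show ?thesis
      using expectation_types_coordinate[OF i, of "\<lambda>t \<tau>. of_bool (left i t = l) * of_bool (\<tau> \<le> j)"]
      by (simp add: left_upd x_def)
  qed
  have payoff: "(\<Sum>i\<in>A t. r (t i)) = (\<Sum>i=1..n. \<Sum>l=1..k. \<Sum>j=1..m.
      w j * of_bool (left i t = l \<and> i \<in> A t \<and> t i \<le> j))" if t: "t \<in> set_pmf (types_pmf n p)" for t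
  proof -
    have "(\<Sum>i\<in>A t. r (t i)) = (\<Sum>i=1..n. of_bool (i \<in> A t) * r (t i))"
      using AD(1) by (intro sum.mono_neutral_cong_left) auto
    \<comment> \<open>For an accepted agent exactly one \<open>l\<close> in \<open>{1..k}\<close> is
      the current number of slots.\<close>
    also have "\<dots> = (\<Sum>i=1..n. \<Sum>l=1..k. of_bool (left i t = l) * (of_bool (i \<in> A t) * r (t i)))"
      using left_pos by (intro sum.cong refl) (auto simp flip: sum_distrib_right)
    also have "\<dots> = (\<Sum>i=1..n. \<Sum>l=1..k. \<Sum>j=1..m.
        w j * of_bool (left i t = l \<and> i \<in> A t \<and> t i \<le> j))"
      using types_range[OF t]
      by (intro sum.cong refl) (simp add: r_eq_indicator sum_distrib_left of_bool_conj mult_ac)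
    finally show ?thesis .
  qed
  have "policy_value n r p (return_pmf A) = ?E (\<lambda>t. \<Sum>i=1..n. \<Sum>l=1..k. \<Sum>j=1..m.
      w j * of_bool (left i t = l \<and> i \<in> A t \<and> t i \<le> j))"
    unfolding policy_value_return using payoff by (intro integral_cong_AE) (auto simp: AE_measure_pmf_iff)
  also have "\<dots> = (\<Sum>i=1..n. \<Sum>l=1..k. \<Sum>j=1..m.
      w j * ?E (\<lambda>t. of_bool (left i t = l \<and> i \<in> A t \<and> t i \<le> j)))"
    by (simp add: integrable_types del: sum_mult_of_bool_eq sum_of_bool_mult_eq)
  also have "\<dots> \<le> (\<Sum>i=1..n. \<Sum>l=1..k. \<Sum>j=1..m. w j * min (y i l) (G i j * x i l))"
  proof (intro sum_mono mult_left_mono w_nonneg min.boundedI)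
    fix i l j assume i: "i \<in> {1..n}" and j: "j \<in> {1..m}"
    show "?E (\<lambda>t. of_bool (left i t = l \<and> i \<in> A t \<and> t i \<le> j)) \<le> y i l"
      unfolding y_def by (intro integral_mono integrable_types) auto
    have "?E (\<lambda>t. of_bool (left i t = l \<and> i \<in> A t \<and> t i \<le> j))
        \<le> ?E (\<lambda>t. of_bool (left i t = l) * of_bool (t i \<le> j) :: real)"
      by (intro integral_mono integrable_types) auto
    then show "?E (\<lambda>t. of_bool (left i t = l \<and> i \<in> A t \<and> t i \<le> j)) \<le> G i j * x i l"
      using xG[OF i, of j l] j by simp
  qed auto
  also have "\<dots> = (\<Sum>j=1..m. w j * lp_row k n G x y j)"
    by (simp only: weighted_lp_rows)
  finally show ?thesis using flow by blast
qed

lemma DP_le: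
  assumes "\<And>x y. lp_flow k n x y \<Longrightarrow> (\<Sum>j=1..m. w j * lp_row k n G x y j) \<le> c"
  shows "DP k n r p \<le> c"
proof -
  have "return_pmf (greedy k) \<in> policies k n" by (simp add: policies_def greedy_det)
  moreover have "policy_value n r p D \<le> c" if "D \<in> policies k n" for D
    using policy_value_le[OF _ that] det_policy_flow assms order_trans by blast
  ultimately show ?thesis unfolding DP_def by (intro cSUP_least) auto
qed

text \<open>Every flow is bounded by \<open>val 1 k\<close>, the value of the greedy policy. The
  same bound makes the policy values bounded, so their supremum is an upper bound.\<close>

lemma DP_ge:
  assumes "lp_flow k n x y" "k \<ge> 1" "n \<ge> 1"
  shows "(\<Sum>j=1..m. w j * lp_row k n G x y j) \<le> DP k n r p"
proof -
  have "policy_value n r p D \<le> val 1 k" if "D \<in> policies k n" for D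
    using policy_value_le[OF _ that] det_policy_flow lp_rows_le_val[OF _ assms(2,3)] order_trans by blast
  then have "bdd_above (policy_value n r p ` policies k n)" by (rule bdd_aboveI2)
  then have "val 1 k \<le> DP k n r p"
    unfolding DP_def policy_value_greedy[symmetric]
    by (intro cSUP_upper) (simp_all add: policies_def greedy_det)
  then show ?thesis using lp_rows_le_val[OF assms] by linarith
qed

end

section \<open>Benchmarks as linear functionals of the weights\<close>

context weighted_instance
begin

text \<open>For each threshold an admissible set contains at most \<open>min\<close> of the count
  and \<open>k\<close> agents; choosing the best agents attains all these bounds
  simultaneously.\<close>

lemma Max_eq_weighted_counts:
  assumes t: "\<And>i. i \<in> {1..n} \<Longrightarrow> t i \<in> {1..m}"
  shows "Max ((\<lambda>S. \<Sum>i\<in>S. r (t i)) ` {S. S \<subseteq> {1..n} \<and> card S \<le> k}) =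
    (\<Sum>j=1..m. w j * min (\<Sum>i=1..n. of_bool (t i \<le> j)) (real k))"
proof -
  have fin: "finite S" if "S \<subseteq> {1..n}" for S using that finite_subset by blast
  have count: "(\<Sum>i=1..n. of_bool (t i \<le> j)) = real (card {i\<in>{1..n}. t i \<le> j})" for j
    by (simp add: Int_def)
  have sum_r: "(\<Sum>i\<in>S. r (t i)) = (\<Sum>j=1..m. w j * real (card {i\<in>S. t i \<le> j}))" if S: "S \<subseteq> {1..n}" for S
  proof -
    have "(\<Sum>i\<in>S. r (t i)) = (\<Sum>i\<in>S. \<Sum>j=1..m. w j * of_bool (t i \<le> j))"
      using t S by (intro sum.cong refl r_eq_indicator) auto
    also have "\<dots> = (\<Sum>j=1..m. \<Sum>i\<in>S. w j * of_bool (t i \<le> j))" by (rule sum.swap)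
    also have "\<dots> = (\<Sum>j=1..m. w j * real (card {i\<in>S. t i \<le> j}))"
      using fin[OF S] by (simp add: Int_def mult.commute flip: sum_distrib_left)
    finally show ?thesis .
  qed
  show ?thesis
  proof (rule Max_eqI)
    show "finite ((\<lambda>S. \<Sum>i\<in>S. r (t i)) ` {S. S \<subseteq> {1..n} \<and> card S \<le> k})" by simp
  next
    fix v assume "v \<in> (\<lambda>S. \<Sum>i\<in>S. r (t i)) ` {S. S \<subseteq> {1..n} \<and> card S \<le> k}"
    then obtain S where S: "S \<subseteq> {1..n}" "card S \<le> k" "v = (\<Sum>i\<in>S. r (t i))" by blast
    show "v \<le> (\<Sum>j=1..m. w j * min (\<Sum>i=1..n. of_bool (t i \<le> j)) (real k))"
      unfolding S(3) sum_r[OF S(1)] count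
    proof (intro sum_mono mult_left_mono w_nonneg)
      fix j
      have "card {i\<in>S. t i \<le> j} \<le> card {i\<in>{1..n}. t i \<le> j}" using S(1) by (intro card_mono) auto
      moreover have "card {i\<in>S. t i \<le> j} \<le> card S" using fin[OF S(1)] by (intro card_mono) auto
      ultimately show "real (card {i\<in>S. t i \<le> j}) \<le> min (real (card {i\<in>{1..n}. t i \<le> j})) (real k)"
        using S(2) by simp
    qed
  next
    obtain S where S: "S \<subseteq> {1..n}" "card S \<le> k"
      "\<And>j. card {i\<in>S. t i \<le> j} = min (card {i\<in>{1..n}. t i \<le> j}) k"
      using ex_subset_minimizing[of "{1..n}" k t] by auto
    have "(\<Sum>j=1..m. w j * min (\<Sum>i=1..n. of_bool (t i \<le> j)) (real k)) = (\<Sum>i\<in>S. r (t i))"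
      unfolding sum_r[OF S(1)] count S(3) by (simp add: of_nat_min)
    then show "(\<Sum>j=1..m. w j * min (\<Sum>i=1..n. of_bool (t i \<le> j)) (real k))
        \<in> (\<lambda>S. \<Sum>i\<in>S. r (t i)) ` {S. S \<subseteq> {1..n} \<and> card S \<le> k}"
      using S(1,2) by blast
  qed
qed

lemma Q_Proph_eq:
  assumes j: "j \<in> {1..m}"
  shows "Q_Proph k n G j = measure_pmf.expectation (types_pmf n p)
    (\<lambda>t. min (\<Sum>i=1..n. of_bool (t i \<le> j)) (real k))"
proof -
  \<comment> \<open>The event is written \<open>\<tau> \<in> {1..j}\<close> rather than
    \<open>\<tau> \<le> j\<close> so that the default type \<open>0\<close> goes to the default
    \<open>False\<close>, as pushing the product forward requires.\<close>
  have bern: "bernoulli_pmf (G i j) = map_pmf (\<lambda>\<tau>. \<tau> \<in> {1..j}) (p i)" if i: "i \<in> {1..n}" for i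
  proof -
    have "measure_pmf.prob (p i) {1..j} = G i j"
      using j by (simp add: G_eq[OF i] measure_measure_pmf_finite)
    moreover have "(\<lambda>\<tau>. \<tau> \<in> {1..j}) -` {True} = {1..j}"
      by (simp only: vimage_def singleton_iff eq_True Collect_mem_eq)
    ultimately have True_eq: "pmf (map_pmf (\<lambda>\<tau>. \<tau> \<in> {1..j}) (p i)) True = G i j"
      by (simp only: pmf_map)
    then have "0 \<le> G i j" "G i j \<le> 1" by (metis pmf_nonneg, metis pmf_le_1)
    then have "pmf (bernoulli_pmf (G i j)) b = pmf (map_pmf (\<lambda>\<tau>. \<tau> \<in> {1..j}) (p i)) b" for b
      by (cases b) (simp_all only: True_eq pmf_False_conv_True pmf_bernoulli_True)
    then show ?thesis by (rule pmf_eqI)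
  qed
  have "Pi_pmf {1..n} False (\<lambda>i. bernoulli_pmf (G i j)) =
      Pi_pmf {1..n} False (\<lambda>i. map_pmf (\<lambda>\<tau>. \<tau> \<in> {1..j}) (p i))"
    using bern by (intro Pi_pmf_cong) auto
  also have "\<dots> = map_pmf (\<lambda>t. (\<lambda>\<tau>. \<tau> \<in> {1..j}) \<circ> t) (types_pmf n p)"
    unfolding types_pmf_def by (rule Pi_pmf_map) auto
  finally have "Q_Proph k n G j = measure_pmf.expectation (types_pmf n p)
      (\<lambda>t. min (\<Sum>i=1..n. of_bool (t i \<in> {1..j})) (real k))"
    by (simp only: Q_Proph_def integral_map_pmf comp_apply)
  also have "\<dots> = measure_pmf.expectation (types_pmf n p)
      (\<lambda>t. min (\<Sum>i=1..n. of_bool (t i \<le> j)) (real k))"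
  proof (intro integral_cong_AE)
    show "AE t in measure_pmf (types_pmf n p). min (\<Sum>i=1..n. of_bool (t i \<in> {1..j})) (real k) =
        min (\<Sum>i=1..n. of_bool (t i \<le> j)) (real k)"
      unfolding AE_measure_pmf_iff using types_range
      by (intro ballI arg_cong[of _ _ "\<lambda>s. min s (real k)"] sum.cong) auto
  qed auto
  finally show ?thesis .
qed

lemma Proph_eq: "Proph k n r p = (\<Sum>j=1..m. w j * Q_Proph k n G j)"
proof -
  have "Proph k n r p = measure_pmf.expectation (types_pmf n p)
      (\<lambda>t. \<Sum>j=1..m. w j * min (\<Sum>i=1..n. of_bool (t i \<le> j)) (real k))"
    unfolding Proph_def
    using Max_eq_weighted_counts types_range by (intro integral_cong_AE) (auto simp: AE_measure_pmf_iff)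
  also have "\<dots> = (\<Sum>j=1..m. w j * measure_pmf.expectation (types_pmf n p)
      (\<lambda>t. min (\<Sum>i=1..n. of_bool (t i \<le> j)) (real k)))"
    by (simp only: integral_mult_right_zero Bochner_Integration.integral_sum integrable_types)
  also have "\<dots> = (\<Sum>j=1..m. w j * Q_Proph k n G j)"
    by (intro sum.cong refl arg_cong[of _ _ "\<lambda>q. _ * q"]) (simp only: Q_Proph_eq)
  finally show ?thesis .
qed

text \<open>Filling capacity from the best type downwards maximizes all partial sums of the
  allocation together, and the objective is a nonnegative combination of these partial sums.\<close>

lemma ExAnte_eq: "ExAnte k n m r p = (\<Sum>j=1..m. w j * Q_ExAnte k n G j)"
proof -
  define C where "C = {a. (\<Sum>j=1..m. a j) \<le> real k \<and>
    (\<forall>j\<in>{1..m}. 0 \<le> a j \<and> a j \<le> (\<Sum>i=1..n. pmf (p i) j))}"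
  define S where "S j = (\<Sum>i=1..n. G i j)" for j
  define M where "M j = min (S j) (real k)" for j
  \<comment> \<open>The optimal allocation: the increments of the expected supply capped at
    \<open>k\<close>.\<close>
  define a where "a j = M j - M (j - 1)" for j
  have S_diff: "S j = S (j - 1) + (\<Sum>i=1..n. pmf (p i) j)" if "j \<in> {1..m}" for j
  proof -
    have "S j - S (j - 1) = (\<Sum>i=1..n. pmf (p i) j)"
      unfolding S_def sum_subtractf[symmetric] using that by (intro sum.cong refl G_diff)
    then show ?thesis by simp
  qed
  have M0: "M 0 = 0" by (simp add: M_def S_def G_0)
  have "(\<Sum>j=1..m. a j) = M m" unfolding a_def sum_diff_pred M0 by simp
  moreover have "0 \<le> a j \<and> a j \<le> (\<Sum>i=1..n. pmf (p i) j)" if j: "j \<in> {1..m}" for j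
  proof -
    have "0 \<le> (\<Sum>i=1..n. pmf (p i) j)" by (simp add: sum_nonneg)
    then show ?thesis unfolding a_def M_def S_diff[OF j] by linarith
  qed
  ultimately have aC: "a \<in> C" by (auto simp: C_def M_def)
  have val_a: "(\<Sum>j=1..m. r j * a j) = (\<Sum>j=1..m. w j * Q_ExAnte k n G j)"
    using sum_by_parts[of M m r w, OF M0 r_eq] by (simp add: a_def M_def S_def Q_ExAnte_def)
  have upper: "(\<Sum>j=1..m. r j * b j) \<le> (\<Sum>j=1..m. w j * Q_ExAnte k n G j)" if b: "b \<in> C" for b
  proof -
    define B where "B j = (\<Sum>j'=1..j. b j')" for j
    have "b j = B j - B (j - 1)" if "j \<in> {1..m}" for j using that by (cases j) (auto simp: B_def)
    then have "(\<Sum>j=1..m. r j * b j) = (\<Sum>j=1..m. r j * (B j - B (j - 1)))" by simp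
    also have "\<dots> = (\<Sum>j=1..m. w j * B j)" by (rule sum_by_parts) (simp_all add: B_def r_eq)
    also have "\<dots> \<le> (\<Sum>j=1..m. w j * Q_ExAnte k n G j)"
    proof (intro sum_mono mult_left_mono w_nonneg)
      fix j assume j: "j \<in> {1..m}"
      have "B j \<le> (\<Sum>j'=1..j. \<Sum>i=1..n. pmf (p i) j')"
        unfolding B_def using b j by (intro sum_mono) (auto simp: C_def)
      also have "\<dots> = S j"
        unfolding S_def by (subst sum.swap) (use j in \<open>simp add: G_eq\<close>)
      finally have "B j \<le> S j" .
      moreover have "B j \<le> (\<Sum>j=1..m. b j)"
        unfolding B_def using b j by (intro sum_mono2) (auto simp: C_def)
      ultimately show "B j \<le> Q_ExAnte k n G j" using b by (simp add: Q_ExAnte_def S_def C_def)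
    qed
    finally show ?thesis .
  qed
  show ?thesis
    unfolding ExAnte_def C_def[symmetric]
  proof (rule cSup_eq_maximum)
    show "(\<Sum>j=1..m. w j * Q_ExAnte k n G j) \<in> (\<lambda>b. \<Sum>j=1..m. r j * b j) ` C"
      unfolding val_a[symmetric] by (rule imageI[OF aC])
  next
    fix v assume "v \<in> (\<lambda>b. \<Sum>j=1..m. r j * b j) ` C"
    then show "v \<le> (\<Sum>j=1..m. w j * Q_ExAnte k n G j)" using upper by (elim imageE) simp
  qed
qed

end

section \<open>Duality between instances and the inner LP\<close>

lemma type_dist_nonneg:
  assumes "(m, G) \<in> type_dists n" "i \<in> {1..n}" "j \<le> m"
  shows "0 \<le> G i j"
  using assms(3)
proof (induction j)
  case 0
  then show ?case using assms(1,2) by (simp add: type_dists_def)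
next
  case (Suc j)
  have "G i j \<le> G i (Suc j)" using assms(1,2) Suc.prems by (simp add: type_dists_def)
  then show ?case using Suc by linarith
qed

lemma type_dists_obtain_pmf:
  assumes G: "(m, G) \<in> type_dists n"
  obtains p where "\<And>i. i \<in> {1..n} \<Longrightarrow> set_pmf (p i) \<subseteq> {1..m}"
    "\<And>i j. i \<in> {1..n} \<Longrightarrow> j \<le> m \<Longrightarrow> G i j = (\<Sum>j'=1..j. pmf (p i) j')"
proof -
  have "\<exists>q. set_pmf q \<subseteq> {1..m} \<and> (\<forall>j\<le>m. G i j = (\<Sum>j'=1..j. pmf q j'))" if i: "i \<in> {1..n}" for i
  proof -
    define g where "g j = (if j \<in> {1..m} then G i j - G i (j - 1) else 0)" for j
    have nn: "0 \<le> g j" for j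
      using G i by (cases j) (auto simp: g_def type_dists_def)
    have sum_g: "(\<Sum>j'=1..j. g j') = G i j" if "j \<le> m" for j
    proof -
      have "(\<Sum>j'=1..j. g j') = (\<Sum>j'=1..j. G i j' - G i (j' - 1))"
        using that by (intro sum.cong) (auto simp: g_def)
      then show ?thesis using G i unfolding sum_diff_pred by (simp add: type_dists_def)
    qed
    have "(\<integral>\<^sup>+j. ennreal (g j) \<partial>count_space UNIV) = (\<Sum>j=1..m. ennreal (g j))"
      by (intro nn_integral_count_space') (auto simp: g_def)
    also have "\<dots> = ennreal (\<Sum>j=1..m. g j)" using nn by (intro sum_ennreal) auto
    also have "\<dots> = 1" using sum_g[of m] G i by (simp add: type_dists_def)
    finally have 1: "(\<integral>\<^sup>+j. ennreal (g j) \<partial>count_space UNIV) = 1" .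
    have "pmf (embed_pmf g) j = g j" for j by (rule pmf_embed_pmf[OF nn 1])
    moreover have "set_pmf (embed_pmf g) \<subseteq> {1..m}"
      unfolding set_embed_pmf[OF nn 1] by (auto simp: g_def)
    ultimately show ?thesis using sum_g by (intro exI[of _ "embed_pmf g"]) simp
  qed
  then obtain p where "\<forall>i\<in>{1..n}. set_pmf (p i) \<subseteq> {1..m} \<and> (\<forall>j\<le>m. G i j = (\<Sum>j'=1..j. pmf (p i) j'))"
    by metis
  then show ?thesis using that by blast
qed

lemma instance_weighted:
  assumes I: "(m, r, p) \<in> instances n"
  shows "weighted_instance n m r p (\<lambda>j. if j < m then r j - r (Suc j) else r m) (\<lambda>i j. \<Sum>j'=1..j. pmf (p i) j')"
    and "(m, \<lambda>i j. \<Sum>j'=1..j. pmf (p i) j') \<in> type_dists n"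
proof -
  \<comment> \<open>The separate last weight implements \<open>r (m + 1) = 0\<close>, as the actual
    value \<open>r (Suc m)\<close> is arbitrary.\<close>
  let ?w = "\<lambda>j. if j < m then r j - r (Suc j) else r m"
  show W: "weighted_instance n m r p ?w (\<lambda>i j. \<Sum>j'=1..j. pmf (p i) j')"
  proof
    fix j assume j: "j \<in> {1..m}"
    then show "0 \<le> ?w j" using I by (auto simp: instances_def)
    have "j \<le> m" using j by simp
    then show "r j = (\<Sum>j'=j..m. ?w j')"
    proof (induction j rule: inc_induct)
      case (step j)
      then show ?case by (simp add: sum.atLeast_Suc_atMost)
    qed simp
  qed (use I in \<open>auto simp: instances_def\<close>)
  then interpret weighted_instance n m r p ?w "\<lambda>i j. \<Sum>j'=1..j. pmf (p i) j'" .
  show "(m, \<lambda>i j. \<Sum>j'=1..j. pmf (p i) j') \<in> type_dists n"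
    using m_pos G_m by (auto simp: type_dists_def)
qed

text \<open>What the duality argument uses of a benchmark. In \<open>Q_last\<close> all
  \<open>n > k\<close> agents are counted and the cap \<open>k\<close> binds; this bounds
  \<open>\<theta>\<close> and supplies a threshold with positive \<open>Q\<close>.\<close>

locale benchmark =
  fixes k n :: nat
    and bench :: "nat \<Rightarrow> (nat \<Rightarrow> real) \<Rightarrow> (nat \<Rightarrow> nat pmf) \<Rightarrow> real"
    and Q :: "(nat \<Rightarrow> nat \<Rightarrow> real) \<Rightarrow> nat \<Rightarrow> real"
  assumes k: "k \<ge> 1" and kn: "k < n"
    and bench_eq: "weighted_instance n m r p w G \<Longrightarrow> bench m r p = (\<Sum>j=1..m. w j * Q G j)"
    and Q_nonneg: "(m, G) \<in> type_dists n \<Longrightarrow> j \<in> {1..m} \<Longrightarrow> 0 \<le> Q G j"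
    and Q_last: "(m, G) \<in> type_dists n \<Longrightarrow> Q G m = real k"
begin

abbreviation value_LP :: "nat \<Rightarrow> (nat \<Rightarrow> nat \<Rightarrow> real) \<Rightarrow> real" where
  "value_LP m G \<equiv> innerLP k n (Q G) m G"

abbreviation positive_instances :: "(nat \<times> (nat \<Rightarrow> real) \<times> (nat \<Rightarrow> nat pmf)) set" where
  "positive_instances \<equiv> {(m, r, p)\<in>instances n. bench m r p > 0}"

abbreviation ratio :: "nat \<times> (nat \<Rightarrow> real) \<times> (nat \<Rightarrow> nat pmf) \<Rightarrow> real" where
  "ratio \<equiv> \<lambda>(m, r, p). DP k n r p / bench m r p"

lemma feasible_0:
  assumes "(m, G) \<in> type_dists n"
  shows "\<exists>x y. innerLP_feasible k n (Q G) m G 0 x y"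
  unfolding innerLP_feasible_iff
  using lp_flow_trivial lp_row_nonneg[OF lp_flow_trivial] type_dist_nonneg[OF assms]
  by (intro exI conjI) auto

lemma bdd_above_feasible:
  assumes G: "(m, G) \<in> type_dists n"
  shows "bdd_above {\<theta>. \<exists>x y. innerLP_feasible k n (Q G) m G \<theta> x y}"
proof (rule bdd_aboveI)
  fix \<theta> assume "\<theta> \<in> {\<theta>. \<exists>x y. innerLP_feasible k n (Q G) m G \<theta> x y}"
  then obtain x y where xy: "innerLP_feasible k n (Q G) m G \<theta> x y" by blast
  have "m \<in> {1..m}" using G by (simp add: type_dists_def)
  then have "\<theta> * k \<le> n"
    using xy Q_last[OF G] lp_row_le[OF _ k] unfolding innerLP_feasible_iff by (metis order_trans)
  then show "\<theta> \<le> n / k" using k by (simp add: field_simps)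
qed

lemma value_LP_nonneg: "(m, G) \<in> type_dists n \<Longrightarrow> 0 \<le> value_LP m G"
  unfolding innerLP_def using feasible_0 bdd_above_feasible by (intro cSup_upper) auto

text \<open>Weak duality: multiply constraint \<open>j\<close> by \<open>w j\<close> and
  add.\<close>

lemma value_LP_le_ratio:
  assumes "weighted_instance n m r p w G" and G: "(m, G) \<in> type_dists n" and pos: "bench m r p > 0"
  shows "value_LP m G \<le> DP k n r p / bench m r p"
proof -
  interpret weighted_instance n m r p w G by fact
  have "\<theta> \<le> DP k n r p / bench m r p" if xy: "innerLP_feasible k n (Q G) m G \<theta> x y" for \<theta> x y
  proof -
    have "\<theta> * bench m r p = (\<Sum>j=1..m. w j * (\<theta> * Q G j))"
      by (simp add: bench_eq[OF assms(1)] sum_distrib_left mult_ac)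
    also have "\<dots> \<le> (\<Sum>j=1..m. w j * lp_row k n G x y j)"
      using xy by (intro sum_mono mult_left_mono w_nonneg) (auto simp: innerLP_feasible_iff)
    also have "\<dots> \<le> DP k n r p"
      using xy k kn by (intro DP_ge) (auto simp: innerLP_feasible_iff)
    finally show ?thesis using pos by (simp add: pos_le_divide_eq)
  qed
  then show ?thesis
    unfolding innerLP_def using feasible_0[OF G] by (intro cSup_least) auto
qed

text \<open>Strong duality by separation: the separating weights become differences of valuations.
  The margin \<open>\<epsilon>\<close> makes the violation of the constraints uniform.\<close>

lemma ex_ratio_le:
  assumes G: "(m, G) \<in> type_dists n" and \<epsilon>: "\<epsilon> > 0"
  shows "\<exists>I\<in>positive_instances. ratio I \<le> value_LP m G + \<epsilon>"
proof -
  define \<theta> where "\<theta> = value_LP m G + \<epsilon>"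
  \<comment> \<open>Constraints with \<open>Q G j = 0\<close> hold automatically because rows are
    nonnegative. On the rest \<open>Q\<close> is at least the minimum \<open>q > 0\<close>.\<close>
  define J where "J = {j\<in>{1..m}. Q G j > 0}"
  define K where "K = {v. \<exists>x y. lp_flow k n x y \<and> v = (\<lambda>j. lp_row k n G x y j - \<theta> * Q G j)}"
  define q where "q = Min (Q G ` J)"
  have m: "m \<ge> 1" using G by (simp add: type_dists_def)
  have finJ: "finite J" and mJ: "m \<in> J" using m k by (auto simp: J_def Q_last[OF G])
  have q: "q > 0" "\<And>j. j \<in> J \<Longrightarrow> q \<le> Q G j"
  proof -
    have "q \<in> Q G ` J" unfolding q_def using finJ mJ by (intro Min_in) auto
    then show "q > 0" by (auto simp: J_def)
    show "q \<le> Q G j" if "j \<in> J" for j unfolding q_def using finJ that by (intro Min_le) auto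
  qed
  have V: "0 \<le> value_LP m G" by (rule value_LP_nonneg[OF G])
  have "\<exists>w. (\<forall>j\<in>J. 0 \<le> w j) \<and> (\<exists>j\<in>J. 0 < w j) \<and> (\<forall>v\<in>K. (\<Sum>j\<in>J. w j * v j) \<le> 0)"
  proof (rule ex_separating_weights[OF finJ])
    show "K \<noteq> {}" using lp_flow_trivial unfolding K_def by blast
  next
    fix u v and t :: real assume uv: "u \<in> K" "v \<in> K" and t: "0 \<le> t" "t \<le> 1"
    obtain x y where u: "lp_flow k n x y" "u = (\<lambda>j. lp_row k n G x y j - \<theta> * Q G j)"
      using uv(1) unfolding K_def by blast
    obtain x' y' where v: "lp_flow k n x' y'" "v = (\<lambda>j. lp_row k n G x' y' j - \<theta> * Q G j)"
      using uv(2) unfolding K_def by blast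
    let ?x = "\<lambda>i l. (1 - t) * x i l + t * x' i l" and ?y = "\<lambda>i l. (1 - t) * y i l + t * y' i l"
    have "(1 - t) * u j + t * v j \<le> lp_row k n G ?x ?y j - \<theta> * Q G j" for j
      using lp_row_concave[OF t, of k n G x y j x' y'] unfolding u(2) v(2) by (simp add: algebra_simps)
    then show "\<exists>z\<in>K. \<forall>j\<in>J. (1 - t) * u j + t * v j \<le> z j"
      using lp_flow_convex[OF u(1) v(1) t]
      by (intro bexI[of _ "\<lambda>j. lp_row k n G ?x ?y j - \<theta> * Q G j"]) (auto simp: K_def)
  next
    fix v j assume v: "v \<in> K" and j: "j \<in> J"
    obtain x y where xy: "lp_flow k n x y" "v = (\<lambda>j. lp_row k n G x y j - \<theta> * Q G j)"
      using v unfolding K_def by blast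
    have "0 \<le> lp_row k n G x y j" "lp_row k n G x y j \<le> n"
      using lp_row_nonneg[OF xy(1)] lp_row_le[OF xy(1) k] type_dist_nonneg[OF G] j by (auto simp: J_def)
    moreover have "0 \<le> \<theta> * Q G j" "Q G j \<le> Max (Q G ` J)"
      using V \<epsilon> j finJ by (auto simp: \<theta>_def J_def intro!: Max_ge)
    moreover have "\<theta> * Q G j \<le> \<theta> * Max (Q G ` J)"
      using calculation(4) V \<epsilon> by (intro mult_left_mono) (auto simp: \<theta>_def)
    ultimately show "\<bar>v j\<bar> \<le> n + \<theta> * Max (Q G ` J)" unfolding xy(2) by linarith
  next
    fix v assume "v \<in> K"
    then obtain x y where xy: "lp_flow k n x y" "v = (\<lambda>j. lp_row k n G x y j - \<theta> * Q G j)"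
      unfolding K_def by blast
    \<comment> \<open>Already at \<open>\<theta>'\<close> some constraint fails. Raising
      \<open>\<theta>'\<close> to \<open>\<theta>\<close> adds
      \<open>\<epsilon> / 2 * Q G j\<close>, so the slack is at most
      \<open>- (\<epsilon> / 2 * q)\<close> for every flow.\<close>
    define \<theta>' where "\<theta>' = value_LP m G + \<epsilon> / 2"
    have "\<not> innerLP_feasible k n (Q G) m G \<theta>' x y"
    proof
      assume "innerLP_feasible k n (Q G) m G \<theta>' x y"
      then have "\<theta>' \<le> value_LP m G"
        unfolding innerLP_def by (intro cSup_upper bdd_above_feasible[OF G]) auto
      then show False using \<epsilon> by (simp add: \<theta>'_def)
    qed
    then obtain j where j: "j \<in> {1..m}" "lp_row k n G x y j < \<theta>' * Q G j"
      using xy(1) unfolding innerLP_feasible_iff by auto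
    have "0 \<le> lp_row k n G x y j" using lp_row_nonneg[OF xy(1)] type_dist_nonneg[OF G] j(1) by auto
    then have "0 < \<theta>' * Q G j" using j(2) by linarith
    then have jJ: "j \<in> J" using j(1) V \<epsilon> by (auto simp: J_def \<theta>'_def zero_less_mult_iff)
    have "\<epsilon> / 2 * q \<le> \<epsilon> / 2 * Q G j" using q(2)[OF jJ] \<epsilon> by simp
    moreover have "\<theta> * Q G j = \<theta>' * Q G j + \<epsilon> / 2 * Q G j"
      by (simp add: \<theta>_def \<theta>'_def field_simps)
    ultimately have "v j \<le> - (\<epsilon> / 2 * q)" using j(2) unfolding xy(2) by linarith
    then show "\<exists>j\<in>J. v j \<le> - (\<epsilon> / 2 * q)" using jJ by blast
  next
    show "0 < \<epsilon> / 2 * q" using \<epsilon> q(1) by simp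
  qed
  then obtain w0 where w0: "\<And>j. j \<in> J \<Longrightarrow> 0 \<le> w0 j" "\<exists>j\<in>J. 0 < w0 j"
    "\<And>v. v \<in> K \<Longrightarrow> (\<Sum>j\<in>J. w0 j * v j) \<le> 0" by blast
  define w where "w j = (if j \<in> J then w0 j else 0)" for j
  define r where "r j = (\<Sum>j'=j..m. w j')" for j
  obtain p where p: "\<And>i. i \<in> {1..n} \<Longrightarrow> set_pmf (p i) \<subseteq> {1..m}"
    "\<And>i j. i \<in> {1..n} \<Longrightarrow> j \<le> m \<Longrightarrow> G i j = (\<Sum>j'=1..j. pmf (p i) j')"
    using type_dists_obtain_pmf[OF G] by blast
  have w_nn: "0 \<le> w j" for j using w0(1) by (simp add: w_def)
  have W: "weighted_instance n m r p w G"
    using m p w_nn by unfold_locales (auto simp: r_def)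
  then interpret weighted_instance n m r p w G .
  have sum_w: "(\<Sum>j=1..m. w j * f j) = (\<Sum>j\<in>J. w0 j * f j)" for f :: "nat \<Rightarrow> real"
    by (intro sum.mono_neutral_cong_right) (auto simp: w_def J_def)
  have pos: "bench m r p > 0"
  proof -
    obtain j where "j \<in> J" "0 < w0 j" using w0(2) by blast
    then have "0 < (\<Sum>j\<in>J. w0 j * Q G j)"
      using finJ w0(1) by (intro sum_pos2[of _ j]) (auto simp: J_def)
    then show ?thesis by (simp only: bench_eq[OF W] sum_w)
  qed
  have "DP k n r p \<le> \<theta> * bench m r p"
  proof (rule DP_le)
    fix x y assume "lp_flow k n x y"
    then have "(\<Sum>j\<in>J. w0 j * (lp_row k n G x y j - \<theta> * Q G j)) \<le> 0"
      by (intro w0(3)[of "\<lambda>j. lp_row k n G x y j - \<theta> * Q G j"]) (auto simp: K_def)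
    then have "(\<Sum>j\<in>J. w0 j * lp_row k n G x y j) \<le> \<theta> * (\<Sum>j\<in>J. w0 j * Q G j)"
      by (simp add: right_diff_distrib sum_subtractf sum_distrib_left mult_ac)
    then show "(\<Sum>j=1..m. w j * lp_row k n G x y j) \<le> \<theta> * bench m r p"
      by (simp only: bench_eq[OF W] sum_w)
  qed
  then have "DP k n r p / bench m r p \<le> \<theta>" using pos by (simp add: pos_divide_le_eq)
  moreover have "(m, r, p) \<in> instances n"
  proof -
    have "r (Suc j) \<le> r j" if "j \<in> {1..<m}" for j
      unfolding r_def using w_nn by (intro sum_mono2) auto
    moreover have "0 \<le> r m" unfolding r_def using w_nn by (simp add: sum_nonneg)
    ultimately show ?thesis using m p(1) by (simp add: instances_def)
  qed
  ultimately show ?thesis using pos by (intro bexI[of _ "(m, r, p)"]) (auto simp: \<theta>_def)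
qed

lemma ratio_ge:
  assumes "I \<in> positive_instances"
  shows "\<exists>(m, G)\<in>type_dists n. value_LP m G \<le> ratio I"
proof -
  obtain m r p where I: "I = (m, r, p)" "(m, r, p) \<in> instances n" "bench m r p > 0" using assms by auto
  show ?thesis
    using value_LP_le_ratio[OF instance_weighted[OF I(2)] I(3)] instance_weighted(2)[OF I(2)]
    by (auto simp: I(1))
qed

theorem INF_ratio_eq: "(INF I\<in>positive_instances. ratio I) = (INF (m, G)\<in>type_dists n. value_LP m G)"
proof (rule antisym)
  \<comment> \<open>A single type. It shows that \<open>type_dists n\<close> is nonempty and,
    through \<open>ex_ratio_le\<close>, that an instance with positive benchmark exists, so both
    infima are over nonempty sets.\<close>
  have G0: "(1, \<lambda>i j. of_bool (j = 1)) \<in> type_dists n" by (simp add: type_dists_def)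
  have LP_nonneg: "0 \<le> (case z of (m, G) \<Rightarrow> value_LP m G)" if "z \<in> type_dists n" for z
    using that value_LP_nonneg by (cases z) simp
  have ratio_nonneg: "0 \<le> ratio I" if "I \<in> positive_instances" for I
    using ratio_ge[OF that] LP_nonneg by fastforce
  have bdd: "bdd_below (ratio ` positive_instances)"
    "bdd_below ((\<lambda>(m, G). value_LP m G) ` type_dists n)"
    using ratio_nonneg LP_nonneg by (intro bdd_belowI2; blast)+
  show "(INF I\<in>positive_instances. ratio I) \<le> (INF (m, G)\<in>type_dists n. value_LP m G)"
  proof (rule cINF_greatest)
    show "type_dists n \<noteq> {}" using G0 by blast
    fix z assume z: "z \<in> type_dists n"
    obtain m G where mG: "z = (m, G)" by fastforce
    show "(INF I\<in>positive_instances. ratio I) \<le> (case z of (m, G) \<Rightarrow> value_LP m G)"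
    proof (rule field_le_epsilon)
      fix \<epsilon> :: real assume "\<epsilon> > 0"
      then obtain I where "I \<in> positive_instances" "ratio I \<le> value_LP m G + \<epsilon>"
        using ex_ratio_le z mG by blast
      then show "(INF I\<in>positive_instances. ratio I) \<le> (case z of (m, G) \<Rightarrow> value_LP m G) + \<epsilon>"
        using cINF_lower[OF bdd(1)] mG by fastforce
    qed
  qed
  show "(INF (m, G)\<in>type_dists n. value_LP m G) \<le> (INF I\<in>positive_instances. ratio I)"
  proof (rule cINF_greatest)
    show "positive_instances \<noteq> {}" using ex_ratio_le[OF G0, of 1] by auto
    fix I assume "I \<in> positive_instances"
    then obtain m G where mG: "(m, G) \<in> type_dists n" "value_LP m G \<le> ratio I"
      using ratio_ge by fast
    show "(INF (m, G)\<in>type_dists n. value_LP m G) \<le> ratio I"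
      by (rule cINF_lower2[OF bdd(2) mG(1)]) (simp add: mG(2))
  qed
qed

end

section \<open>The prophet and ex-ante benchmarks as instances of the duality\<close>

lemma benchmark_Proph:
  assumes "k \<ge> 1" "k < n"
  shows "benchmark k n (\<lambda>m. Proph k n) (Q_Proph k n)"
proof (unfold_locales, fact+)
  show "Proph k n r p = (\<Sum>j=1..m. w j * Q_Proph k n G j)" if "weighted_instance n m r p w G" for m r p w G
    using weighted_instance.Proph_eq[OF that] .
  show "0 \<le> Q_Proph k n G j" for G j
    unfolding Q_Proph_def by (intro integral_nonneg_AE) (auto intro!: sum_nonneg)
  show "Q_Proph k n G m = real k" if "(m, G) \<in> type_dists n" for m G
  proof -
    have "bernoulli_pmf (1::real) = return_pmf True"
    proof (rule pmf_eqI)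
      show "pmf (bernoulli_pmf (1::real)) b = pmf (return_pmf True) b" for b by (cases b) simp_all
    qed
    then have "Pi_pmf {1..n} False (\<lambda>i. bernoulli_pmf (G i m)) = Pi_pmf {1..n} False (\<lambda>i. return_pmf True)"
      using that by (intro Pi_pmf_cong) (auto simp: type_dists_def)
    moreover have "{Suc 0..n} \<inter> {i. Suc 0 \<le> i \<and> i \<le> n} = {Suc 0..n}" by auto
    ultimately show ?thesis using assms by (simp add: Q_Proph_def Pi_pmf_return_pmf)
  qed
qed

lemma benchmark_ExAnte:
  assumes "k \<ge> 1" "k < n"
  shows "benchmark k n (ExAnte k n) (Q_ExAnte k n)"
proof (unfold_locales, fact+)
  show "ExAnte k n m r p = (\<Sum>j=1..m. w j * Q_ExAnte k n G j)" if "weighted_instance n m r p w G" for m r p w G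
    using weighted_instance.ExAnte_eq[OF that] .
  show "0 \<le> Q_ExAnte k n G j" if "(m, G) \<in> type_dists n" "j \<in> {1..m}" for m G j
    using type_dist_nonneg[OF that(1)] that(2) by (auto simp: Q_ExAnte_def intro!: sum_nonneg)
  show "Q_ExAnte k n G m = real k" if "(m, G) \<in> type_dists n" for m G
    using that assms by (simp add: Q_ExAnte_def type_dists_def)
qed

theorem theorem1:
  fixes k n :: nat
  assumes "k \<ge> 1" and "n > k"
  shows "(INF (m, r, p)\<in>{(m, r, p)\<in>instances n. Proph k n r p > 0}.
            DP k n r p / Proph k n r p)
         = (INF (m, G)\<in>type_dists n. innerLP_DP_Proph k n m G)
       \<and> (INF (m, r, p)\<in>{(m, r, p)\<in>instances n. ExAnte k n m r p > 0}.
            DP k n r p / ExAnte k n m r p)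
         = (INF (m, G)\<in>type_dists n. innerLP_DP_ExAnte k n m G)"
  using benchmark.INF_ratio_eq[OF benchmark_Proph[OF assms]]
    benchmark.INF_ratio_eq[OF benchmark_ExAnte[OF assms]]
  unfolding innerLP_DP_Proph_def innerLP_DP_ExAnte_def by blast

end
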